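(* Let $D\ge 3$. For each $N\ge 1$ let $(T_{\vec n})_{\vec n\in\{1,\dots,N\}^D}$ be $N^D$ independent, identically distributed complex random variables, whose common law does not depend on $N$, has finite moments of all orders, is even (i.e. $\mathbb E[T_{\vec n}^{a}\,\overline{T_{\vec n}}^{\,b}]=0$ whenever $a\ne b$), and has covariance $\mathbb E[T_{\vec n}\overline{T_{\vec n}}]=\sigma^2$. Let $\mathbb T_{\vec n}=N^{-\frac{D-1}{2}}\,T_{\vec n}$. Then, as $N\to\infty$, the tensor $\mathbb T$ converges in distribution to a Gaussian tensor of covariance $\sigma^2$; that is, for every connected closed $D$-colored graph $\mathcal B$, $$\lim_{N\to\infty}N^{-1+\Omega(\mathcal B)}\;\mathbb E\big[\mathrm{Tr}_{\mathcal B}(\mathbb T,\bar{\mathbb T})\big]=\sigma^{2k(\mathcal B)}\,R(\mathcal B).$$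
   Context: Colored graphs. A closed $D$-colored graph $\mathcal B$ is a finite bipartite multigraph, with vertices split into white vertices $v$ and black vertices $\bar v$ in equal numbers, every edge joining a white and a black vertex and carrying a color in $\{1,\dots,D\}$, such that every vertex is incident to exactly one edge of each color. $2k(\mathcal B)$ is its number of vertices, and $\mathcal E^i(\mathcal B)$ its set of edges of color $i$. Closed $(D+1)$-colored graphs are defined in the same way with colors $\{0,1,\dots,D\}$. For colors $i\neq j$, a face of colors $ij$ is a connected component of the subgraph formed by the edges of colors $i$ and $j$; $F^{ij}$ is the number of faces of colors $ij$. Trace invariants. For a tensor $\mathbb T_{n^1\dots n^D}$, $n^i\in\{1,\dots,N\}$, with complex conjugate $\bar{\mathbb T}$, $$\mathrm{Tr}_{\mathcal B}(\mathbb T,\bar{\mathbb T})=\sum_{n,\bar n}\Big(\prod_{i=1}^D\prod_{(v,\bar v)\in\mathcal E^i(\mathcal B)}\delta_{n^i_v\bar n^i_{\bar v}}\Big)\prod_{v}\mathbb T_{\vec n_v}\prod_{\bar v}\bar{\mathbb T}_{\vec{\bar n}_{\bar v}},$$ where each white vertex $v$ carries $\vec n_v=(n_v^1,\dots,n_v^D)$, each black vertex $\bar v$ carries $\vec{\bar n}_{\bar v}$, and the sum runs over all these indices in $\{1,\dots,N\}$. Covering graphs. A covering graph of a connected closed $D$-colored graph $\mathcal B$ is a closed $(D+1)$-colored graph $\mathcal G$ on the same vertex set as $\mathcal B$ such that deleting the edges of color $0$ of $\mathcal G$ gives $\mathcal B$ (vertices are distinguished, so there are $k(\mathcal B)!$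 covering graphs). A minimal covering graph is a covering graph for which $\sum_{i=1}^DF^{0i}(\mathcal G)$ is maximal among all covering graphs of $\mathcal B$. $R(\mathcal B)$ is the number of minimal covering graphs of $\mathcal B$ and $$\Omega(\mathcal B)=1+(D-1)k(\mathcal B)-\max_{\mathcal G\text{ covering }\mathcal B}\ \sum_{i=1}^DF^{0i}(\mathcal G).$$ These are exactly the numbers such that $\lim_{N\to\infty} N^{-1+\Omega(\mathcal B)}\langle\mathrm{Tr}_{\mathcal B}(\mathbb T,\bar{\mathbb T})\rangle_{\sigma^2}=\sigma^{2k(\mathcal B)}R(\mathcal B)$, where $\langle\cdot\rangle_{\sigma^2}$ is the expectation when the entries of $\mathbb T$ are independent centered complex Gaussians with $\langle\mathbb T_{\vec n}\bar{\mathbb T}_{\vec n}\rangle=\sigma^2/N^{D-1}$. *)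

theory Defs
  imports "HOL-Probability.Probability"
begin

section \<open>Colored graphs\<close>

text \<open>
  The edges of color \<open>i\<close> form a set of pairs (white vertex, black vertex). In a closed colored
  graph each color is a perfect matching, so two vertices are joined by at most one edge of each
  given color, and parallel edges always have distinct colors: a set per color loses nothing.
\<close>

record 'v colored_graph =
  whites :: "'v set"
  blacks :: "'v set"
  edges :: "nat \<Rightarrow> ('v \<times> 'v) set"

definition vertices :: "'v colored_graph \<Rightarrow> 'v set" where
  "vertices G = whites G \<union> blacks G"

text \<open>
  \<open>C\<close> is the set of colors, \<open>{1..D}\<close> or \<open>{0..D}\<close> below. Colors outside \<open>C\<close> are required to
  carry no edges, so that equality of records is equality of graphs; this matters when graphs
  are counted.
\<close>

definition closed_colored_graph :: "nat set \<Rightarrow> 'v colored_graph \<Rightarrow> bool" where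
  "closed_colored_graph C G \<longleftrightarrow>
     finite (whites G) \<and> finite (blacks G) \<and>
     whites G \<inter> blacks G = {} \<and>
     card (whites G) = card (blacks G) \<and>
     (\<forall>i\<in>C. edges G i \<subseteq> whites G \<times> blacks G \<and>
        (\<forall>v\<in>whites G. \<exists>!w. (v, w) \<in> edges G i) \<and>
        (\<forall>w\<in>blacks G. \<exists>!v. (v, w) \<in> edges G i)) \<and>
     (\<forall>i. i \<notin> C \<longrightarrow> edges G i = {})"

definition half_order :: "'v colored_graph \<Rightarrow> nat" where
  "half_order G = card (vertices G) div 2"

text \<open>
  Connected components, given by their vertex sets, of the spanning subgraph formed by the
  edges whose color is in \<open>C\<close>.
\<close>

definition color_components :: "nat set \<Rightarrow> 'v colored_graph \<Rightarrow> 'v set set" where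
  "color_components C G =
     vertices G // {(x, y) \<in> vertices G \<times> vertices G.
       (x, y) \<in> ((\<Union>i\<in>C. edges G i) \<union> (\<Union>i\<in>C. edges G i)\<inverse>)\<^sup>*}"

definition connected_colored_graph :: "nat set \<Rightarrow> 'v colored_graph \<Rightarrow> bool" where
  "connected_colored_graph C G \<longleftrightarrow> card (color_components C G) = 1"

definition num_faces :: "'v colored_graph \<Rightarrow> nat \<Rightarrow> nat \<Rightarrow> nat" where
  "num_faces G i j = card (color_components {i, j} G)"


section \<open>Covering graphs\<close>

definition delete_color :: "nat \<Rightarrow> 'v colored_graph \<Rightarrow> 'v colored_graph" where
  "delete_color c G = G\<lparr>edges := (edges G)(c := {})\<rparr>"

definition covering_graphs :: "nat \<Rightarrow> 'v colored_graph \<Rightarrow> 'v colored_graph set" where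
  "covering_graphs D B = {G. closed_colored_graph {0..D} G \<and> delete_color 0 G = B}"

definition zero_faces :: "nat \<Rightarrow> 'v colored_graph \<Rightarrow> nat" where
  "zero_faces D G = (\<Sum>i\<in>{1..D}. num_faces G 0 i)"

definition minimal_covering_graphs :: "nat \<Rightarrow> 'v colored_graph \<Rightarrow> 'v colored_graph set" where
  "minimal_covering_graphs D B =
     {G \<in> covering_graphs D B. \<forall>H\<in>covering_graphs D B. zero_faces D H \<le> zero_faces D G}"

definition num_minimal_coverings :: "nat \<Rightarrow> 'v colored_graph \<Rightarrow> nat" where
  "num_minimal_coverings D B = card (minimal_covering_graphs D B)"

definition Omega :: "nat \<Rightarrow> 'v colored_graph \<Rightarrow> int" where
  "Omega D B = 1 + (int D - 1) * int (half_order B)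
     - int (Max (zero_faces D ` covering_graphs D B))"


section \<open>Tensors and trace invariants\<close>

definition tensor_indices :: "nat \<Rightarrow> nat \<Rightarrow> (nat \<Rightarrow> nat) set" where
  "tensor_indices D N = {1..D} \<rightarrow>\<^sub>E {1..N}"

text \<open>\<open>S\<close> is the tensor placed at the black vertices; it is the complex conjugate of \<open>T\<close> in use.\<close>

definition trace_invariant ::
  "nat \<Rightarrow> nat \<Rightarrow> 'v colored_graph \<Rightarrow> ((nat \<Rightarrow> nat) \<Rightarrow> complex) \<Rightarrow> ((nat \<Rightarrow> nat) \<Rightarrow> complex) \<Rightarrow> complex"
  where
  "trace_invariant D N B T S =
     (\<Sum>n \<in> whites B \<rightarrow>\<^sub>E tensor_indices D N. \<Sum>m \<in> blacks B \<rightarrow>\<^sub>E tensor_indices D N.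
        (\<Prod>i\<in>{1..D}. \<Prod>(v, w)\<in>edges B i. of_bool (n v i = m w i)) *
        (\<Prod>v\<in>whites B. T (n v)) * (\<Prod>w\<in>blacks B. S (m w)))"

definition rescaled_tensor ::
  "nat \<Rightarrow> nat \<Rightarrow> ((nat \<Rightarrow> nat) \<Rightarrow> complex) \<Rightarrow> (nat \<Rightarrow> nat) \<Rightarrow> complex" where
  "rescaled_tensor D N T n = complex_of_real (real N powr (- (real D - 1) / 2)) * T n"

end

theory Submission
  imports Defs
begin

text \<open>
  Labelling every vertex of \<open>B\<close> by a tensor index turns the expected trace into a sum over
  labellings \<open>h\<close> satisfying the delta constraints of \<open>B\<close>. By independence and evenness a
  labelling contributes only if every index occurs equally often on white and on black vertices,
  i.e. if \<open>h\<close> is constant along the 0-edges of some covering graph \<open>G\<close>; exactly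
  \<open>N ^ zero_faces D G\<close> labellings are compatible with \<open>G\<close>. If \<open>h\<close> is injective on the white
  vertices, then \<open>G\<close> is unique and the contribution is \<open>\<sigma> ^ (2 k)\<close>, as in the Gaussian case.
  Coincidences are suppressed: if \<open>h\<close> agrees at two white vertices, then either some color \<open>i\<close> has
  the two corresponding 0-edges on different \<open>0i\<close>-faces, and the coincidence removes a free index,
  or exchanging the black ends of the two 0-edges does not affect \<open>h\<close> but increases the number of
  \<open>0i\<close>-faces for every \<open>i\<close>. In both cases there are at most \<open>N ^ (max - 1)\<close> such labellings.
\<close>

section \<open>Connected components and labellings constant on them\<close>

text \<open>\<open>conn V R\<close> is the relation whose classes form
  \<open>color_components\<close>, stated for an arbitrary edge relation so that the matching of
  color 0 can be varied.\<close>

definition conn :: "'v set \<Rightarrow> ('v \<times> 'v) set \<Rightarrow> ('v \<times> 'v) set" where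
  "conn V R = {(x, y) \<in> V \<times> V. (x, y) \<in> (R \<union> R\<inverse>)\<^sup>*}"

text \<open>Components are counted and compared through the labellings constant on them, which
  avoids describing the components of a modified graph.\<close>

definition invariants :: "'v set \<Rightarrow> ('v \<times> 'v) set \<Rightarrow> 'a set \<Rightarrow> ('v \<Rightarrow> 'a) set" where
  "invariants V R A = {f \<in> V \<rightarrow>\<^sub>E A. \<forall>(x, y)\<in>R. f x = f y}"

lemma invariants_Int: "invariants V R A \<inter> (V \<rightarrow>\<^sub>E A) = invariants V R A"
  by (auto simp: invariants_def)

lemma equiv_conn: "equiv V (conn V R)"
proof (rule equivI)
  show "conn V R \<subseteq> V \<times> V" by (auto simp: conn_def)
  show "refl_on V (conn V R)" by (auto simp: conn_def refl_on_def)
  have "sym ((R \<union> R\<inverse>)\<^sup>*)" by (intro sym_rtrancl) (auto simp: sym_def)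
  then show "sym (conn V R)" by (auto simp: conn_def sym_def)
  show "trans (conn V R)" by (auto simp: conn_def trans_def)
qed

lemma invariants_conn:
  assumes "f \<in> invariants V R A" "(x, y) \<in> conn V R"
  shows "f x = f y"
proof -
  have "(x, y) \<in> (R \<union> R\<inverse>)\<^sup>*" using assms(2) by (simp add: conn_def)
  then show ?thesis
    by (induction rule: rtrancl_induct) (use assms(1) in \<open>auto simp: invariants_def\<close>)
qed

lemma finite_invariants: "finite V \<Longrightarrow> finite A \<Longrightarrow> finite (invariants V R A)"
  unfolding invariants_def by (rule finite_subset[of _ "V \<rightarrow>\<^sub>E A"]) (auto intro: finite_PiE)

lemma conn_edge: "R \<subseteq> V \<times> V \<Longrightarrow> (x, y) \<in> R \<Longrightarrow> (x, y) \<in> conn V R"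
  by (auto simp: conn_def)

text \<open>A labelling constant along edges is constant on components, hence the same thing as an
  arbitrary function on the quotient.\<close>

lemma card_invariants:
  assumes "finite V" and R: "R \<subseteq> V \<times> V"
  shows "card (invariants V R A) = card A ^ card (V // conn V R)"
proof -
  let ?r = "conn V R"
  let ?F = "\<lambda>g. \<lambda>x\<in>V. g (?r `` {x})"
  have eq: "?r `` {x} = ?r `` {y}" if "(x, y) \<in> ?r" for x y
    using equiv_class_eq[OF equiv_conn that] .
  have "bij_betw ?F ((V // ?r) \<rightarrow>\<^sub>E A) (invariants V R A)"
    unfolding bij_betw_def
  proof (intro conjI set_eqI iffI)
    show "inj_on ?F ((V // ?r) \<rightarrow>\<^sub>E A)"
    proof (rule inj_onI)
      fix g h assume g: "g \<in> (V // ?r) \<rightarrow>\<^sub>E A" and h: "h \<in> (V // ?r) \<rightarrow>\<^sub>E A" and e: "?F g = ?F h"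
      show "g = h"
      proof (rule PiE_ext[OF g h])
        fix c assume "c \<in> V // ?r"
        then obtain x where "x \<in> V" "c = ?r `` {x}" by (auto elim: quotientE)
        then show "g c = h c" using fun_cong[OF e, of x] by simp
      qed
    qed
  next
    fix f assume "f \<in> ?F ` ((V // ?r) \<rightarrow>\<^sub>E A)"
    then obtain g where g: "g \<in> (V // ?r) \<rightarrow>\<^sub>E A" and f: "f = ?F g" by auto
    have "f \<in> V \<rightarrow>\<^sub>E A" unfolding f using g by (auto intro!: quotientI)
    moreover have "f x = f y" if "(x, y) \<in> R" for x y
      using that R eq[OF conn_edge[OF R that]] by (auto simp: f)
    ultimately show "f \<in> invariants V R A" by (auto simp: invariants_def)
  next
    fix f assume f: "f \<in> invariants V R A"
    \<comment> \<open>The inverse reads off \<open>f\<close> at a chosen representative;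
      \<open>some\<close> shows that the choice is irrelevant.\<close>
    define g where "g = (\<lambda>c\<in>V // ?r. f (SOME x. x \<in> c))"
    have some: "f (SOME y. y \<in> ?r `` {x}) = f x" if "x \<in> V" for x
    proof -
      have "x \<in> ?r `` {x}" using that by (auto simp: conn_def)
      then have "(SOME y. y \<in> ?r `` {x}) \<in> ?r `` {x}" by (rule someI)
      then show ?thesis using invariants_conn[OF f] by fastforce
    qed
    have "g \<in> (V // ?r) \<rightarrow>\<^sub>E A"
      using f some by (auto simp: g_def invariants_def elim!: quotientE)
    moreover have "f = ?F g"
    proof
      fix x show "f x = ?F g x"
      proof (cases "x \<in> V")
        case True
        then show ?thesis using some[OF True] by (simp add: g_def quotientI)
      next
        case False
        then show ?thesis using f PiE_arb[of f V "\<lambda>_. A" x] by (simp add: invariants_def)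
      qed
    qed
    ultimately show "f \<in> ?F ` ((V // ?r) \<rightarrow>\<^sub>E A)" by (intro image_eqI[of f ?F g])
  qed
  from bij_betw_same_card[OF this] show ?thesis
    using card_funcsetE[OF finite_quotient[OF \<open>finite V\<close> equiv_type[OF equiv_conn]], of R A]
    by simp
qed

text \<open>Overwriting \<open>f\<close> on the component of \<open>v\<close> by an arbitrary value
  keeps it invariant, and nothing is lost: the new value is read off at \<open>v\<close>, the old
  one at \<open>v'\<close>, whose component is untouched. So forcing \<open>f v = f v'\<close> costs
  a factor \<open>card A\<close>.\<close>

lemma card_invariants_merge:
  assumes "finite V" "finite A" and R: "R \<subseteq> V \<times> V" and v: "v \<in> V" "v' \<in> V"
    and nc: "(v, v') \<notin> conn V R"
  shows "card A * card {f \<in> invariants V R A. f v = f v'} \<le> card (invariants V R A)"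
proof -
  let ?S = "{f \<in> invariants V R A. f v = f v'}"
  let ?F = "\<lambda>(c, f) x. if (v, x) \<in> conn V R then c else f x"
  have tr: "(v, y) \<in> conn V R \<longleftrightarrow> (v, x) \<in> conn V R" if "(x, y) \<in> conn V R" for x y
    using that equiv_conn[of V R] by (meson equivE symD transD)
  have "inj_on ?F (A \<times> ?S)"
  proof (rule inj_onI, clarify, rule conjI)
    fix c f c' f'
    assume f: "f \<in> invariants V R A" "f v = f v'" "f' \<in> invariants V R A" "f' v = f' v'"
      and e: "(\<lambda>x. if (v, x) \<in> conn V R then c else f x) = (\<lambda>x. if (v, x) \<in> conn V R then c' else f' x)"
    have vv: "(v, v) \<in> conn V R" using v by (simp add: conn_def)
    show "c = c'" using fun_cong[OF e, of v] vv by simp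
    have "f v' = f' v'" using fun_cong[OF e, of v'] nc by simp
    show "f = f'"
    proof
      fix x
      show "f x = f' x"
      proof (cases "(v, x) \<in> conn V R")
        case True
        then show ?thesis using invariants_conn[OF f(1) True] invariants_conn[OF f(3) True] f \<open>f v' = f' v'\<close> by simp
      next
        case False then show ?thesis using fun_cong[OF e, of x] by simp
      qed
    qed
  qed
  moreover have "?F ` (A \<times> ?S) \<subseteq> invariants V R A"
    using R tr[OF conn_edge[OF R]]
    by (fastforce simp: invariants_def PiE_iff extensional_def conn_def)
  ultimately have "card (A \<times> ?S) \<le> card (invariants V R A)"
    using finite_invariants[OF assms(1,2)] by (intro card_inj_on_le[of ?F]) auto
  then show ?thesis by (simp add: card_cartesian_product)
qed

text \<open>Exchanging the two arguments of \<open>h\<close> turns it into a family of functions on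
  \<open>V\<close>, one for each \<open>i\<close>; conditions that concern each \<open>i\<close>
  separately then give a product.\<close>

lemma card_indexed_families:
  assumes "finite I"
  shows "card {h \<in> V \<rightarrow>\<^sub>E (I \<rightarrow>\<^sub>E A). \<forall>i\<in>I. (\<lambda>v\<in>V. h v i) \<in> Q i \<inter> (V \<rightarrow>\<^sub>E A)}
       = (\<Prod>i\<in>I. card (Q i \<inter> (V \<rightarrow>\<^sub>E A)))"
proof -
  let ?Q = "\<lambda>i. Q i \<inter> (V \<rightarrow>\<^sub>E A)"
  let ?F = "\<lambda>h. \<lambda>i\<in>I. \<lambda>v\<in>V. h v i"
  let ?G = "\<lambda>h. \<lambda>v\<in>V. \<lambda>i\<in>I. h i v"
  have "bij_betw ?F {h \<in> V \<rightarrow>\<^sub>E (I \<rightarrow>\<^sub>E A). \<forall>i\<in>I. (\<lambda>v\<in>V. h v i) \<in> ?Q i} (Pi\<^sub>E I ?Q)"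
  proof (rule bij_betw_byWitness[of _ ?G])
    have eta: "(\<lambda>v\<in>V. (\<lambda>i\<in>I. h i v) i) = h i" if "h \<in> Pi\<^sub>E I ?Q" "i \<in> I" for h i
    proof -
      have "h i \<in> V \<rightarrow>\<^sub>E A" using that by auto
      then show ?thesis using that(2) by (auto simp: fun_eq_iff PiE_iff extensional_def restrict_def)
    qed
    show "\<forall>h\<in>{h \<in> V \<rightarrow>\<^sub>E (I \<rightarrow>\<^sub>E A). \<forall>i\<in>I. (\<lambda>v\<in>V. h v i) \<in> ?Q i}. ?G (?F h) = h"
      by (auto simp: fun_eq_iff PiE_iff extensional_def restrict_def)
    show "\<forall>h\<in>Pi\<^sub>E I ?Q. ?F (?G h) = h"
      using eta by (auto simp: fun_eq_iff PiE_iff extensional_def restrict_def)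
    show "?F ` {h \<in> V \<rightarrow>\<^sub>E (I \<rightarrow>\<^sub>E A). \<forall>i\<in>I. (\<lambda>v\<in>V. h v i) \<in> ?Q i} \<subseteq> Pi\<^sub>E I ?Q"
      by (auto 0 3 simp: PiE_iff)
    have "(\<lambda>v\<in>V. ?G h v i) \<in> ?Q i" if "h \<in> Pi\<^sub>E I ?Q" "i \<in> I" for h i
    proof -
      have "(\<lambda>v\<in>V. ?G h v i) = h i" using eta[OF that] by (simp cong: restrict_cong)
      then show ?thesis using that by auto
    qed
    moreover have "?G h \<in> V \<rightarrow>\<^sub>E (I \<rightarrow>\<^sub>E A)" if "h \<in> Pi\<^sub>E I ?Q" for h
    proof -
      have "h i v \<in> A" if "v \<in> V" "i \<in> I" for v i
        using PiE_mem[OF \<open>h \<in> Pi\<^sub>E I ?Q\<close> that(2)] that by auto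
      then show ?thesis by (simp add: PiE_iff)
    qed
    ultimately show "?G ` Pi\<^sub>E I ?Q \<subseteq> {h \<in> V \<rightarrow>\<^sub>E (I \<rightarrow>\<^sub>E A). \<forall>i\<in>I. (\<lambda>v\<in>V. h v i) \<in> ?Q i}"
      by (intro image_subsetI CollectI conjI ballI) simp_all
  qed
  from bij_betw_same_card[OF this] show ?thesis unfolding card_PiE[OF assms] .
qed

section \<open>Exchanging edges of a perfect matching\<close>

text \<open>A perfect matching is encoded by a function so that two of its edges can be exchanged by
  a function update.\<close>

definition graph :: "('v \<Rightarrow> 'v) \<Rightarrow> 'v set \<Rightarrow> ('v \<times> 'v) set" where
  "graph t W = (\<lambda>x. (x, t x)) ` W"

lemma invariants_graphs_iff:
  "f \<in> invariants V (graph t W \<union> graph s W) A \<longleftrightarrow>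
     f \<in> V \<rightarrow>\<^sub>E A \<and> (\<forall>x\<in>W. f x = f (t x) \<and> f x = f (s x))"
  unfolding invariants_def graph_def by blast

text \<open>If both matchings send \<open>Q\<close> to the same black vertices, no edge leaves
  \<open>Q\<close> together with these vertices. This set is then a union of components, and its
  indicator is constant on each.\<close>

lemma indicator_invariant:
  fixes W W' :: "'v set"
  assumes "bij_betw t W W'" "bij_betw s W W'" "W \<inter> W' = {}" "Q \<subseteq> W" "t ` Q = s ` Q"
  shows "(\<lambda>x\<in>W \<union> W'. if x \<in> Q \<union> s ` Q then 1 else 0)
    \<in> invariants (W \<union> W') (graph t W \<union> graph s W) {0, 1::nat}"
proof -
  have "t x \<in> t ` Q \<longleftrightarrow> x \<in> Q" "s x \<in> s ` Q \<longleftrightarrow> x \<in> Q" if "x \<in> W" for x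
    using inj_on_image_mem_iff[of t W x Q] inj_on_image_mem_iff[of s W x Q] assms that
    by (simp_all add: bij_betw_def)
  moreover have "x \<notin> s ` Q" "t x \<notin> Q" "s x \<notin> Q" "t x \<in> W'" "s x \<in> W'" if "x \<in> W" for x
  proof -
    have "s ` Q \<subseteq> W'" "t x \<in> W'" "s x \<in> W'"
      using assms(1,2,4) that by (auto simp: bij_betw_def)
    then show "x \<notin> s ` Q" "t x \<notin> Q" "s x \<notin> Q" "t x \<in> W'" "s x \<in> W'"
      using assms(3,4) that by blast+
  qed
  ultimately show ?thesis
    unfolding invariants_graphs_iff by (intro conjI ballI) (simp_all add: assms(5))
qed

text \<open>Two perfect matchings form disjoint alternating cycles, and exchanging the black ends of
  two \<open>t\<close>-edges on one cycle cuts it in two. Instead of cycles, labellings by 0 and 1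
  are compared: all old ones survive and a new one appears, and their number is 2 to the number of
  components.\<close>

lemma card_quotient_swap_less:
  fixes W W' :: "'v set"
  assumes t: "bij_betw t W W'" and s: "bij_betw s W W'" and dis: "W \<inter> W' = {}" and fin: "finite W"
    and v: "v \<in> W" "v' \<in> W" "v \<noteq> v'"
    and c: "(v, v') \<in> conn (W \<union> W') (graph t W \<union> graph s W)"
  shows "card ((W \<union> W') // conn (W \<union> W') (graph t W \<union> graph s W))
    < card ((W \<union> W') // conn (W \<union> W') (graph (t(v := t v', v' := t v)) W \<union> graph s W))"
proof -
  let ?V = "W \<union> W'"
  define t' where "t' = t(v := t v', v' := t v)"
  let ?R = "graph t W \<union> graph s W" and ?R' = "graph t' W \<union> graph s W"
  \<comment> \<open>\<open>p\<close> moves two edges along a cycle: the \<open>t\<close>-edge to a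
    black vertex, then the \<open>s\<close>-edge back to a white one. Its orbits are the white
    vertices of the cycles.\<close>
  define p where "p = inv_into W s \<circ> t"
  have t': "bij_betw t' W W'"
    using t v unfolding t'_def bij_betw_def
    by (intro conjI) (auto simp: inj_on_def image_iff)
  have p: "p ` W \<subseteq> W" "inj_on p W" and sp: "\<And>x. x \<in> W \<Longrightarrow> s (p x) = t x"
  proof -
    have "bij_betw p W W" unfolding p_def by (rule bij_betw_trans[OF t bij_betw_inv_into[OF s]])
    then show "p ` W \<subseteq> W" "inj_on p W" by (auto simp: bij_betw_def)
    show "s (p x) = t x" if "x \<in> W" for x
      using bij_betw_inv_into_right[OF s] bij_betw_apply[OF t that] by (simp add: p_def)
  qed
  have pW: "(p ^^ j) v \<in> W" for j by (induction j) (use v p in auto)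
  \<comment> \<open>Otherwise the indicator of the orbit of \<open>v\<close> would be an invariant
    labelling separating \<open>v\<close> from \<open>v'\<close>, against \<open>c\<close>. The
    orbit is mapped onto itself because \<open>p\<close> is injective and \<open>W\<close> is
    finite.\<close>
  have "\<exists>j. (p ^^ j) v = v'"
  proof -
    define C where "C = range (\<lambda>j. (p ^^ j) v)"
    have CW: "C \<subseteq> W" using pW by (auto simp: C_def)
    have "p ` C \<subseteq> C" unfolding C_def by (auto intro: range_eqI[of _ _ "Suc _"])
    then have "p ` C = C"
      using endo_inj_surj[of C p] finite_subset[OF CW fin] inj_on_subset[OF p(2) CW] by auto
    moreover have "t ` C = s ` p ` C" using sp CW by (force simp: image_image)
    ultimately have "t ` C = s ` C" by simp
    from invariants_conn[OF indicator_invariant[OF t s dis CW this] c]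
    have "v' \<in> C \<union> s ` C" using v by (auto simp: C_def split: if_splits intro: range_eqI[of _ _ 0])
    moreover have "v' \<notin> s ` C" using v CW dis s by (auto simp: bij_betw_def)
    ultimately show ?thesis by (auto simp: C_def)
  qed
  then obtain k where k: "(p ^^ k) v = v'" and min: "\<And>j. j < k \<Longrightarrow> (p ^^ j) v \<noteq> v'"
    using exists_least_iff[of "\<lambda>j. (p ^^ j) v = v'"] by blast
  have "k \<noteq> 0" using k v by (auto intro: ccontr)
  \<comment> \<open>An earlier return to \<open>v\<close> would give a shorter way to
    \<open>v'\<close>, against the minimality of \<open>k\<close>.\<close>
  have ret: "(p ^^ j) v \<noteq> v" if "1 \<le> j" "j \<le> k" for j
  proof
    assume "(p ^^ j) v = v"
    have "(p ^^ (k - j)) ((p ^^ j) v) = v'" using that k by (simp flip: funpow_add[THEN fun_cong, simplified])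
    with \<open>(p ^^ j) v = v\<close> have "(p ^^ (k - j)) v = v'" by simp
    then show False using min[of "k - j"] that \<open>k \<noteq> 0\<close> by simp
  qed
  \<comment> \<open>the white vertices of the part of the cycle from \<open>v\<close> to \<open>v'\<close>, which the exchange closes up\<close>
  define Q where "Q = (\<lambda>j. (p ^^ j) v) ` {1..k}"
  have QW: "Q \<subseteq> W" using pW by (auto simp: Q_def)
  have v'Q: "v' \<in> Q" using k \<open>k \<noteq> 0\<close> by (auto simp: Q_def intro!: image_eqI[of _ _ k])
  have vQ: "v \<notin> Q" using ret by (force simp: Q_def)
  \<comment> \<open>On the arc \<open>t'\<close> agrees with \<open>t\<close> and leads to the next
    white vertex, except at its end \<open>v'\<close>, where it gives \<open>t v = s (p v)\<close>
    and so returns to the first vertex of the arc.\<close>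
  have tp: "t' ((p ^^ j) v) = (if j = k then s (p v) else s ((p ^^ Suc j) v))" if "1 \<le> j" "j \<le> k" for j
  proof (cases "j = k")
    case True then show ?thesis using k v sp by (simp add: t'_def)
  next
    case False
    then have "(p ^^ j) v \<noteq> v'" "(p ^^ j) v \<noteq> v" using min ret that by auto
    then show ?thesis using sp[OF pW, of j] False by (simp add: t'_def)
  qed
  have "t' ` Q = s ` Q"
  proof
    show "t' ` Q \<subseteq> s ` Q"
    proof (clarsimp simp: Q_def)
      fix j assume j: "Suc 0 \<le> j" "j \<le> k"
      show "t' ((p ^^ j) v) \<in> s ` (\<lambda>j. (p ^^ j) v) ` {Suc 0..k}"
      proof (cases "j = k")
        case True then show ?thesis using tp[of j] j by (auto intro!: imageI image_eqI[of _ _ 1])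
      next
        case False then show ?thesis using tp[of j] j by (auto intro!: imageI image_eqI[of _ _ "Suc j"])
      qed
    qed
    then have sub: "t' ` Q \<subseteq> s ` Q" .
    have "card (t' ` Q) = card Q" "card (s ` Q) = card Q"
      using t' s QW by (auto intro!: card_image simp: bij_betw_def intro: inj_on_subset)
    then show "s ` Q \<subseteq> t' ` Q"
      using card_subset_eq[OF _ sub] finite_subset[OF QW fin] by simp
  qed
  note ind = indicator_invariant[OF t' s dis QW this]
  have fV: "finite ?V" using fin t by (metis bij_betw_finite finite_UnI)
  have RV: "?R \<subseteq> ?V \<times> ?V" "?R' \<subseteq> ?V \<times> ?V"
    using t t' s by (auto simp: graph_def bij_betw_def)
  \<comment> \<open>An old labelling takes equal values at \<open>v\<close> and \<open>v'\<close>,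
    so it satisfies the exchanged constraints as well.\<close>
  have "invariants ?V ?R {0,1::nat} \<subseteq> invariants ?V ?R' {0,1}"
  proof
    fix f assume f: "f \<in> invariants ?V ?R {0,1::nat}"
    have "f v = f v'" using invariants_conn[OF f c] .
    moreover have "f x = f (t x)" "f x = f (s x)" if "x \<in> W" for x
      using f that unfolding invariants_graphs_iff by blast+
    ultimately show "f \<in> invariants ?V ?R' {0,1}"
      using f v unfolding invariants_graphs_iff t'_def by simp
  qed
  \<comment> \<open>The indicator of the arc distinguishes \<open>v\<close> from \<open>v'\<close>,
    which lay in one component before the exchange.\<close>
  moreover have "(\<lambda>x\<in>?V. if x \<in> Q \<union> s ` Q then 1 else 0) \<notin> invariants ?V ?R {0, 1::nat}"
  proof
    assume "(\<lambda>x\<in>?V. if x \<in> Q \<union> s ` Q then 1 else 0) \<in> invariants ?V ?R {0, 1::nat}"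
    from invariants_conn[OF this c] show False
      using v v'Q vQ QW s dis by (auto simp: bij_betw_def split: if_splits)
  qed
  ultimately have "invariants ?V ?R {0,1::nat} \<subset> invariants ?V ?R' {0,1}" using ind by blast
  then have "card (invariants ?V ?R {0,1::nat}) < card (invariants ?V ?R' {0,1::nat})"
    by (intro psubset_card_mono finite_invariants fV) auto
  then show ?thesis
    unfolding card_invariants[OF fV RV(1)] card_invariants[OF fV RV(2)] by (simp add: t'_def)
qed

section \<open>Covering graphs and labellings\<close>

lemma perfect_matching_graph:
  assumes "E \<subseteq> W \<times> W'" "\<forall>v\<in>W. \<exists>!w. (v, w) \<in> E" "\<forall>w\<in>W'. \<exists>!v. (v, w) \<in> E"
  shows "\<exists>t. bij_betw t W W' \<and> E = graph t W"
proof -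
  obtain t where t: "\<And>v. v \<in> W \<Longrightarrow> (v, t v) \<in> E" using assms(2) by metis
  have E: "(v, w) \<in> E \<longleftrightarrow> v \<in> W \<and> w = t v" for v w
    using t[of v] assms(1) assms(2)[rule_format, of v] by auto
  have tW: "t v \<in> W'" if "v \<in> W" for v using t[OF that] assms(1) by auto
  have "E = graph t W" unfolding graph_def by (auto simp: E)
  moreover have "inj_on t W"
  proof (rule inj_onI)
    fix x y assume xy: "x \<in> W" "y \<in> W" "t x = t y"
    have "(x, t x) \<in> E" "(y, t x) \<in> E"  using t[OF xy(1)] t[OF xy(2)] xy(3) by simp_all
    then show "x = y" using assms(3) tW[OF xy(1)] by blast
  qed
  moreover have "t ` W = W'"
  proof
    show "t ` W \<subseteq> W'" using tW by auto
    show "W' \<subseteq> t ` W"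
    proof
      fix w assume "w \<in> W'"
      then obtain v where "(v, w) \<in> E" using assms(3) by blast
      then show "w \<in> t ` W" unfolding E by blast
    qed
  qed
  ultimately show ?thesis by (auto simp: bij_betw_def)
qed

lemma graph_perfect_matching:
  assumes "bij_betw t W W'"
  shows "graph t W \<subseteq> W \<times> W'" "v \<in> W \<Longrightarrow> \<exists>!w. (v, w) \<in> graph t W"
    "w \<in> W' \<Longrightarrow> \<exists>!v. (v, w) \<in> graph t W"
  using assms by (auto simp: graph_def bij_betw_def inj_on_def)

text \<open>Bijections between corresponding fibres are glued along the values of \<open>h\<close>.
  This yields a covering graph from a labelling in which every index occurs equally often on white
  and black vertices.\<close>

lemma exists_bij_betw_fibres:
  assumes "finite W" "finite W'"
    and "\<And>x. card {v \<in> W. h v = x} = card {w \<in> W'. h w = x}"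
  shows "\<exists>t. bij_betw t W W' \<and> (\<forall>v\<in>W. h (t v) = h v)"
proof -
  have "\<exists>g. bij_betw g {v \<in> W. h v = x} {w \<in> W'. h w = x}" for x
    using assms by (intro finite_same_card_bij) auto
  then obtain g where g: "\<And>x. bij_betw (g x) {v \<in> W. h v = x} {w \<in> W'. h w = x}" by metis
  define t where "t v = g (h v) v" for v
  have t: "t v \<in> W'" "h (t v) = h v" if "v \<in> W" for v
    using bij_betw_apply[OF g[of "h v"], of v] that by (auto simp: t_def)
  have "inj_on t W"
  proof (rule inj_onI)
    fix x y assume xy: "x \<in> W" "y \<in> W" "t x = t y"
    then have "h x = h y" using t(2) by metis
    then show "x = y"
      using xy bij_betw_imp_inj_on[OF g[of "h x"]] by (auto simp: t_def inj_on_def)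
  qed
  moreover have "w \<in> t ` W" if "w \<in> W'" for w
  proof -
    have "w \<in> g (h w) ` {v \<in> W. h v = h w}"
      using bij_betw_imp_surj_on[OF g[of "h w"]] that by simp
    then obtain v where "v \<in> W" "h v = h w" "w = g (h w) v" by blast
    then show ?thesis by (intro image_eqI[of _ _ v]) (simp_all add: t_def)
  qed
  ultimately have "bij_betw t W W'" using t(1) unfolding bij_betw_def by blast
  then show ?thesis using t(2) by blast
qed

lemma prod_of_bool:
  "finite A \<Longrightarrow> (\<Prod>x\<in>A. of_bool (P x)) = (of_bool (\<forall>x\<in>A. P x) :: 'a::comm_semiring_1)"
  by (induction A rule: finite_induct) auto

lemma prod_fibres:
  fixes f :: "'b \<Rightarrow> 'c::comm_monoid_mult"
  assumes "finite W" "finite S" "h ` W \<subseteq> S"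
  shows "(\<Prod>v\<in>W. f (h v)) = (\<Prod>x\<in>S. f x ^ card {v \<in> W. h v = x})"
proof -
  have "(\<Prod>v\<in>W. f (h v)) = (\<Prod>x\<in>S. \<Prod>v\<in>{v \<in> W. h v = x}. f (h v))"
    by (rule prod.group[symmetric]) (use assms in auto)
  also have "\<dots> = (\<Prod>x\<in>S. f x ^ card {v \<in> W. h v = x})"
    by (intro prod.cong refl) simp
  finally show ?thesis .
qed

section \<open>Covering graphs as bijections from white to black vertices\<close>

locale base_graph =
  fixes D :: nat and B :: "'v colored_graph"
  assumes closed: "closed_colored_graph {1..D} B"
begin

definition cover :: "('v \<Rightarrow> 'v) \<Rightarrow> 'v colored_graph" where
  "cover t = B\<lparr>edges := (edges B)(0 := graph t (whites B))\<rparr>"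

text \<open>Applied to \<open>B\<close>, which has no edges of color 0, this encodes exactly the
  delta constraints of the trace; applied to a covering graph it also requires agreement along the
  0-edges.\<close>

definition labels :: "nat \<Rightarrow> 'v colored_graph \<Rightarrow> ('v \<Rightarrow> nat \<Rightarrow> nat) set" where
  "labels N G = {h \<in> vertices G \<rightarrow>\<^sub>E tensor_indices D N.
     \<forall>i\<in>{1..D}. \<forall>(x, y)\<in>edges G 0 \<union> edges G i. h x i = h y i}"

definition max_faces :: nat where
  "max_faces = Max (zero_faces D ` covering_graphs D B)"

lemma finite_whites: "finite (whites B)" and finite_blacks: "finite (blacks B)"
  and disjoint: "whites B \<inter> blacks B = {}" and card_eq: "card (whites B) = card (blacks B)"
  and no_zero_edges: "edges B 0 = {}"
  using closed by (auto simp: closed_colored_graph_def)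

lemma finite_vertices: "finite (vertices B)"
  by (simp add: vertices_def finite_whites finite_blacks)

lemma half_order_eq: "half_order B = card (whites B)"
  by (simp add: half_order_def vertices_def card_Un_disjoint finite_whites finite_blacks disjoint card_eq)

lemma cover_simps [simp]:
  "whites (cover t) = whites B" "blacks (cover t) = blacks B" "vertices (cover t) = vertices B"
  "edges (cover t) 0 = graph t (whites B)" "i \<noteq> 0 \<Longrightarrow> edges (cover t) i = edges B i"
  by (simp_all add: cover_def vertices_def)

lemma color_graph:
  assumes "i \<in> {1..D}"
  shows "\<exists>s. bij_betw s (whites B) (blacks B) \<and> edges B i = graph s (whites B)"
  using closed assms perfect_matching_graph[of "edges B i" "whites B" "blacks B"]
  unfolding closed_colored_graph_def by blast

lemma edges_subset: "i \<in> {1..D} \<Longrightarrow> edges B i \<subseteq> vertices B \<times> vertices B"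
  using closed by (fastforce simp: closed_colored_graph_def vertices_def)

lemma graph_subset:
  "bij_betw t (whites B) (blacks B) \<Longrightarrow> graph t (whites B) \<subseteq> vertices B \<times> vertices B"
  by (auto simp: graph_def vertices_def bij_betw_def)

lemma covering_graphs_eq: "covering_graphs D B = cover ` {t. bij_betw t (whites B) (blacks B)}"
proof (intro set_eqI iffI)
  fix G assume G: "G \<in> covering_graphs D B"
  then have c: "closed_colored_graph {0..D} G" and d: "B = delete_color 0 G"
    by (auto simp: covering_graphs_def)
  obtain t where t: "bij_betw t (whites G) (blacks G)" "edges G 0 = graph t (whites G)"
    using c perfect_matching_graph[of "edges G 0" "whites G" "blacks G"]
    unfolding closed_colored_graph_def by auto
  have w: "whites B = whites G" "blacks B = blacks G" by (simp_all add: d delete_color_def)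
  have e: "edges B = (edges G)(0 := {})" by (simp add: d delete_color_def)
  have "G = cover t"
    by (rule colored_graph.equality) (simp_all add: cover_def w e flip: t(2))
  with w show "G \<in> cover ` {t. bij_betw t (whites B) (blacks B)}" using t by auto
next
  fix G assume "G \<in> cover ` {t. bij_betw t (whites B) (blacks B)}"
  then obtain t where t: "bij_betw t (whites B) (blacks B)" and G: "G = cover t" by auto
  have "delete_color 0 G = B"
    using no_zero_edges by (simp add: G cover_def delete_color_def fun_upd_idem)
  moreover have "closed_colored_graph {0..D} G"
    using closed graph_perfect_matching[OF t]
    by (auto simp: G closed_colored_graph_def cover_def Ball_def)
  ultimately show "G \<in> covering_graphs D B" by (simp add: covering_graphs_def)
qed

lemma cover_cong: "(\<And>v. v \<in> whites B \<Longrightarrow> t v = t' v) \<Longrightarrow> cover t = cover t'"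
  by (simp add: cover_def graph_def cong: image_cong)

lemma finite_covering_graphs: "finite (covering_graphs D B)"
proof -
  have "covering_graphs D B \<subseteq> cover ` (whites B \<rightarrow>\<^sub>E blacks B)"
  proof
    fix G assume "G \<in> covering_graphs D B"
    then obtain t where t: "bij_betw t (whites B) (blacks B)" and G: "G = cover t"
      by (auto simp: covering_graphs_eq)
    have "restrict t (whites B) \<in> whites B \<rightarrow>\<^sub>E blacks B" using bij_betw_apply[OF t] by auto
    moreover have "G = cover (restrict t (whites B))" unfolding G by (rule cover_cong) simp
    ultimately show "G \<in> cover ` (whites B \<rightarrow>\<^sub>E blacks B)" by blast
  qed
  then show ?thesis
    by (rule finite_subset) (simp add: finite_PiE finite_whites finite_blacks)
qed

lemma covering_graphs_nonempty: "covering_graphs D B \<noteq> {}"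
  using finite_same_card_bij[OF finite_whites finite_blacks card_eq] by (auto simp: covering_graphs_eq)

lemma zero_faces_le: "G \<in> covering_graphs D B \<Longrightarrow> zero_faces D G \<le> max_faces"
  unfolding max_faces_def by (intro Max_ge) (auto simp: finite_covering_graphs)

lemma minimal_covering_graphs_eq:
  "minimal_covering_graphs D B = {G \<in> covering_graphs D B. zero_faces D G = max_faces}"
proof -
  have "max_faces \<in> zero_faces D ` covering_graphs D B"
    unfolding max_faces_def using finite_covering_graphs covering_graphs_nonempty by (intro Max_in) auto
  then obtain H where "H \<in> covering_graphs D B" "zero_faces D H = max_faces" by auto
  then show ?thesis
    using zero_faces_le unfolding minimal_covering_graphs_def by (metis (mono_tags, lifting) order_antisym)
qed

section \<open>Counting the labellings compatible with a covering graph\<close>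

lemma zero_faces_cover:
  "zero_faces D (cover t) = (\<Sum>i\<in>{1..D}. card (vertices B //
     conn (vertices B) (graph t (whites B) \<union> edges B i)))"
  by (simp add: zero_faces_def num_faces_def color_components_def conn_def)

text \<open>A 0-edge imposes equality in every color, and tensor indices are extensional, so its two
  ends carry the same index.\<close>

lemma labels_cover:
  assumes t: "bij_betw t (whites B) (blacks B)"
  shows "labels N (cover t) = {h \<in> labels N B. \<forall>v\<in>whites B. h (t v) = h v}"
proof -
  have ext: "(\<forall>i\<in>{1..D}. h v i = h (t v) i) \<longleftrightarrow> h (t v) = h v"
    if "h \<in> vertices B \<rightarrow>\<^sub>E tensor_indices D N" "v \<in> whites B" for h v
  proof -
    have "v \<in> vertices B" "t v \<in> vertices B"
      using that(2) bij_betw_apply[OF t] by (auto simp: vertices_def)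
    then have "h v \<in> tensor_indices D N" "h (t v) \<in> tensor_indices D N" using that(1) by auto
    then show ?thesis unfolding tensor_indices_def by (metis PiE_ext)
  qed
  show ?thesis
  proof (intro set_eqI iffI)
    fix h assume h: "h \<in> labels N (cover t)"
    then have hV: "h \<in> vertices B \<rightarrow>\<^sub>E tensor_indices D N" by (simp add: labels_def)
    have "h v = h (t v)" if "v \<in> whites B" for v
    proof -
      have "\<forall>i\<in>{1..D}. h v i = h (t v) i" using h that by (simp add: labels_def graph_def ball_Un)
      then show ?thesis using ext[OF hV that] by simp
    qed
    moreover have "h \<in> labels N B"
      using h by (auto simp: labels_def no_zero_edges ball_Un)
    ultimately show "h \<in> {h \<in> labels N B. \<forall>v\<in>whites B. h (t v) = h v}" by simp
  next
    fix h assume "h \<in> {h \<in> labels N B. \<forall>v\<in>whites B. h (t v) = h v}"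
    then show "h \<in> labels N (cover t)"
      by (simp add: labels_def graph_def no_zero_edges ball_Un)
  qed
qed

lemma finite_labels: "finite (labels N B)"
  unfolding labels_def tensor_indices_def
  by (rule finite_subset[of _ "vertices B \<rightarrow>\<^sub>E ({1..D} \<rightarrow>\<^sub>E {1..N})"])
    (auto intro!: finite_PiE simp: finite_vertices)

text \<open>The constraints decouple by color: the coordinate of \<open>h\<close> in color
  \<open>i\<close> only has to be constant on the faces of colors \<open>0i\<close>.\<close>

lemma labels_cover_eq:
  assumes t: "bij_betw t (whites B) (blacks B)"
  shows "labels N (cover t) = {h \<in> vertices B \<rightarrow>\<^sub>E ({1..D} \<rightarrow>\<^sub>E {1..N}). \<forall>i\<in>{1..D}.
    (\<lambda>v\<in>vertices B. h v i) \<in> invariants (vertices B) (graph t (whites B) \<union> edges B i) {1..N}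
      \<inter> (vertices B \<rightarrow>\<^sub>E {1..N})}"
proof (intro set_eqI)
  fix h
  show "h \<in> labels N (cover t) \<longleftrightarrow> h \<in> {h \<in> vertices B \<rightarrow>\<^sub>E ({1..D} \<rightarrow>\<^sub>E {1..N}). \<forall>i\<in>{1..D}.
    (\<lambda>v\<in>vertices B. h v i) \<in> invariants (vertices B) (graph t (whites B) \<union> edges B i) {1..N}
      \<inter> (vertices B \<rightarrow>\<^sub>E {1..N})}" (is "_ \<longleftrightarrow> _ \<in> ?R")
  proof (cases "h \<in> vertices B \<rightarrow>\<^sub>E ({1..D} \<rightarrow>\<^sub>E {1..N})")
    case True
    have "(\<forall>(x, y)\<in>graph t (whites B) \<union> edges B i. h x i = h y i) \<longleftrightarrow>
       (\<lambda>v\<in>vertices B. h v i) \<in> invariants (vertices B) (graph t (whites B) \<union> edges B i) {1..N}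
      \<inter> (vertices B \<rightarrow>\<^sub>E {1..N})" if "i \<in> {1..D}" for i
    proof -
      have "(\<lambda>v\<in>vertices B. h v i) \<in> vertices B \<rightarrow>\<^sub>E {1..N}"
        using True that by (auto simp: PiE_iff simp del: atLeastAtMost_iff)
      moreover have "h x i = h y i \<longleftrightarrow> (\<lambda>v\<in>vertices B. h v i) x = (\<lambda>v\<in>vertices B. h v i) y"
        if "(x, y) \<in> graph t (whites B) \<union> edges B i" for x y
      proof -
        have "x \<in> vertices B" "y \<in> vertices B"
          using that edges_subset[OF \<open>i \<in> {1..D}\<close>] graph_subset[OF t] by blast+
        then show ?thesis by simp
      qed
      ultimately show ?thesis unfolding invariants_def by blast
    qed
    moreover have "edges (cover t) i = edges B i" if "i \<in> {1..D}" for i using that by simp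
    ultimately show ?thesis using True
      by (simp add: labels_def tensor_indices_def del: atLeastAtMost_iff)
  next
    case False then show ?thesis by (simp add: labels_def tensor_indices_def)
  qed
qed

text \<open>Each face of colors \<open>0i\<close> carries one freely chosen value in
  \<open>{1..N}\<close>, independently for different \<open>i\<close>.\<close>

lemma card_labels_cover:
  assumes t: "bij_betw t (whites B) (blacks B)"
  shows "card (labels N (cover t)) = N ^ zero_faces D (cover t)"
proof -
  have "card (labels N (cover t))
    = (\<Prod>i\<in>{1..D}. card (invariants (vertices B) (graph t (whites B) \<union> edges B i) {1..N}))"
    unfolding labels_cover_eq[OF t]
    by (subst card_indexed_families) (simp_all only: finite_atLeastAtMost invariants_Int)
  also have "\<dots> = (\<Prod>i\<in>{1..D}. N ^ card (vertices B // conn (vertices B) (graph t (whites B) \<union> edges B i)))"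
    using graph_subset[OF t] edges_subset
    by (intro prod.cong refl, subst card_invariants) (auto simp: finite_vertices)
  finally show ?thesis by (simp add: zero_faces_cover power_sum)
qed

text \<open>The dichotomy is whether some color \<open>j\<close> separates \<open>v\<close> from
  \<open>v'\<close>. If so, the collision loses a factor \<open>N\<close> in color \<open>j\<close>;
  if not, exchanging two 0-edges shows that the covering graph is not minimal, and even the set of
  all its labellings is small enough.\<close>

lemma card_labels_collision:
  assumes t: "bij_betw t (whites B) (blacks B)" and D: "D \<ge> 1"
    and v: "v \<in> whites B" "v' \<in> whites B" "v \<noteq> v'"
  shows "N * card {h \<in> labels N (cover t). h v = h v'} \<le> N ^ max_faces"
proof (cases "N = 0 \<or> (\<forall>i\<in>{1..D}. (v, v') \<in> conn (vertices B) (graph t (whites B) \<union> edges B i))")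
  case True
  show ?thesis
  proof (cases "N = 0")
    case False
    let ?t = "t(v := t v', v' := t v)"
    have t': "bij_betw ?t (whites B) (blacks B)"
      using t v unfolding bij_betw_def by (intro conjI) (auto simp: inj_on_def image_iff)
    \<comment> \<open>Every color gains at least one face, and \<open>D \<ge> 1\<close> provides a
      color, so the sum grows strictly.\<close>
    have "zero_faces D (cover t) < zero_faces D (cover ?t)"
      unfolding zero_faces_cover
    proof (rule sum_strict_mono)
      fix i assume i: "i \<in> {1..D}"
      obtain s where s: "bij_betw s (whites B) (blacks B)" "edges B i = graph s (whites B)"
        using color_graph[OF i] by blast
      have c: "(v, v') \<in> conn (vertices B) (graph t (whites B) \<union> edges B i)"
        using True False i by blast
      show "card (vertices B // conn (vertices B) (graph t (whites B) \<union> edges B i))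
          < card (vertices B // conn (vertices B) (graph ?t (whites B) \<union> edges B i))"
        using card_quotient_swap_less[OF t s(1) disjoint finite_whites v c[unfolded s(2) vertices_def]]
        by (simp only: s(2) vertices_def)
    qed (use D in auto)
    also have "\<dots> \<le> max_faces" using t' by (intro zero_faces_le) (auto simp: covering_graphs_eq)
    finally have "Suc (zero_faces D (cover t)) \<le> max_faces" by simp
    then have "N ^ Suc (zero_faces D (cover t)) \<le> N ^ max_faces" using False by (intro power_increasing) auto
    moreover have "card {h \<in> labels N (cover t). h v = h v'} \<le> card (labels N (cover t))"
      by (intro card_mono) (auto simp: labels_cover[OF t] finite_labels)
    ultimately show ?thesis
      unfolding card_labels_cover[OF t] power_Suc by (meson mult_le_mono2 order_trans)
  qed simp
next
  case False
  then obtain j where N: "N \<noteq> 0" and j: "j \<in> {1..D}"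
    and nc: "(v, v') \<notin> conn (vertices B) (graph t (whites B) \<union> edges B j)" by auto
  let ?V = "vertices B" and ?R = "\<lambda>i. graph t (whites B) \<union> edges B i"
  let ?I = "\<lambda>i. invariants ?V (?R i) {1..N}"
  \<comment> \<open>For an upper bound it suffices to keep the equality at \<open>v\<close> and
    \<open>v'\<close> in the separating color \<open>j\<close>.\<close>
  let ?Q = "\<lambda>i. if i = j then {f \<in> ?I j. f v = f v'} else ?I i"
  have vV: "v \<in> ?V" "v' \<in> ?V" using v by (auto simp: vertices_def)
  have RV: "?R j \<subseteq> ?V \<times> ?V" using graph_subset[OF t] edges_subset[OF j] by blast
  have QI: "?Q i \<inter> (?V \<rightarrow>\<^sub>E {1..N}) = ?Q i" for i by (auto simp: invariants_def)
  have "{h \<in> labels N (cover t). h v = h v'}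
     \<subseteq> {h \<in> ?V \<rightarrow>\<^sub>E ({1..D} \<rightarrow>\<^sub>E {1..N}). \<forall>i\<in>{1..D}. (\<lambda>v\<in>?V. h v i) \<in> ?Q i \<inter> (?V \<rightarrow>\<^sub>E {1..N})}"
    unfolding labels_cover_eq[OF t] using vV by auto
  then have "card {h \<in> labels N (cover t). h v = h v'} \<le>
     card {h \<in> ?V \<rightarrow>\<^sub>E ({1..D} \<rightarrow>\<^sub>E {1..N}). \<forall>i\<in>{1..D}. (\<lambda>v\<in>?V. h v i) \<in> ?Q i \<inter> (?V \<rightarrow>\<^sub>E {1..N})}"
    by (intro card_mono finite_subset[OF Collect_restrict] finite_PiE finite_vertices finite_atLeastAtMost)
  also have "\<dots> = (\<Prod>i\<in>{1..D}. card (?Q i))"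
    by (subst card_indexed_families) (simp_all only: finite_atLeastAtMost QI)
  finally have "N * card {h \<in> labels N (cover t). h v = h v'} \<le> N * (\<Prod>i\<in>{1..D}. card (?Q i))"
    by (rule mult_le_mono2)
  also have "\<dots> = (N * card {f \<in> ?I j. f v = f v'}) * (\<Prod>i\<in>{1..D} - {j}. card (?I i))"
    using j by (simp add: prod.remove mult.assoc)
  also have "\<dots> \<le> card (?I j) * (\<Prod>i\<in>{1..D} - {j}. card (?I i))"
    using card_invariants_merge[OF finite_vertices _ RV vV nc, of "{1..N}"] by (intro mult_le_mono1) simp
  also have "\<dots> = (\<Prod>i\<in>{1..D}. card (?I i))" using j by (simp add: prod.remove)
  also have "\<dots> = card (labels N (cover t))"
    unfolding labels_cover_eq[OF t]
    by (subst card_indexed_families) (simp_all only: finite_atLeastAtMost invariants_Int)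
  also have "\<dots> = N ^ zero_faces D (cover t)" by (rule card_labels_cover[OF t])
  also have "\<dots> \<le> N ^ max_faces"
    using N t by (intro power_increasing zero_faces_le) (auto simp: covering_graphs_eq)
  finally show ?thesis .
qed

section \<open>Trace invariants as sums over labellings\<close>

lemma trace_invariant_labels:
  "trace_invariant D N B T S = (\<Sum>h\<in>labels N B. (\<Prod>v\<in>whites B. T (h v)) * (\<Prod>w\<in>blacks B. S (h w)))"
proof -
  let ?W = "whites B" and ?W' = "blacks B" and ?V = "vertices B" and ?I = "tensor_indices D N"
  \<comment> \<open>White and black vertices are disjoint, so a pair of labellings
    \<open>(n, m)\<close> is the same as one labelling of all vertices; restriction is the
    inverse.\<close>
  let ?j = "\<lambda>(n, m). \<lambda>x\<in>?V. if x \<in> ?W then n x else m x"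
  let ?P = "\<lambda>n m. \<forall>i\<in>{1..D}. \<forall>(v, w)\<in>edges B i. n v i = m w i"
  have fin: "finite (edges B i)" if "i \<in> {1..D}" for i
    using finite_subset[OF edges_subset[OF that]] finite_vertices by simp
  have deltas: "(\<Prod>i\<in>{1..D}. \<Prod>(v, w)\<in>edges B i. of_bool (n v i = m w i)) = (of_bool (?P n m) :: complex)" for n m
  proof -
    have "(\<Prod>(v, w)\<in>edges B i. of_bool (n v i = m w i))
        = (of_bool (\<forall>(v, w)\<in>edges B i. n v i = m w i) :: complex)" if "i \<in> {1..D}" for i
      using prod_of_bool[OF fin[OF that], of "\<lambda>(v, w). n v i = m w i"] by (simp add: case_prod_unfold)
    then have "(\<Prod>i\<in>{1..D}. \<Prod>(v, w)\<in>edges B i. of_bool (n v i = m w i))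
        = (\<Prod>i\<in>{1..D}. of_bool (\<forall>(v, w)\<in>edges B i. n v i = m w i) :: complex)"
      by (intro prod.cong refl)
    then show ?thesis by (simp only: prod_of_bool finite_atLeastAtMost)
  qed
  have "trace_invariant D N B T S = (\<Sum>(n, m)\<in>(?W \<rightarrow>\<^sub>E ?I) \<times> (?W' \<rightarrow>\<^sub>E ?I).
      of_bool (?P n m) * ((\<Prod>v\<in>?W. T (n v)) * (\<Prod>w\<in>?W'. S (m w))))"
    unfolding trace_invariant_def sum.cartesian_product
    by (intro sum.cong refl, clarify) (simp only: deltas mult.assoc)
  also have "\<dots> = (\<Sum>h\<in>?V \<rightarrow>\<^sub>E ?I.
      of_bool (?P h h) * ((\<Prod>v\<in>?W. T (h v)) * (\<Prod>w\<in>?W'. S (h w))))"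
  proof (rule sum.reindex_bij_witness[where i = "\<lambda>h. (restrict h ?W, restrict h ?W')"
        and j = ?j])
    fix a assume "a \<in> (?W \<rightarrow>\<^sub>E ?I) \<times> (?W' \<rightarrow>\<^sub>E ?I)"
    then obtain n m where a: "a = (n, m)" "n \<in> ?W \<rightarrow>\<^sub>E ?I" "m \<in> ?W' \<rightarrow>\<^sub>E ?I" by auto
    let ?h = "\<lambda>x\<in>?V. if x \<in> ?W then n x else m x"
    have hW: "?h v = n v" if "v \<in> ?W" for v using that by (simp add: vertices_def)
    have hW': "?h w = m w" if "w \<in> ?W'" for w using that disjoint by (auto simp: vertices_def)
    have "restrict ?h ?W = n" "restrict ?h ?W' = m"
      using restrict_ext[of ?W ?h n, OF hW] restrict_ext[of ?W' ?h m, OF hW']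
      unfolding PiE_restrict[OF a(2)] PiE_restrict[OF a(3)] by blast+
    then show "(\<lambda>h. (restrict h ?W, restrict h ?W')) (?j a) = a"
      by (simp only: a prod.case)
    show "?j a \<in> ?V \<rightarrow>\<^sub>E ?I"
      using a by (auto simp: vertices_def)
    have P: "?P ?h ?h \<longleftrightarrow> ?P n m"
    proof (intro ball_cong refl)
      fix i x assume "i \<in> {1..D}" "x \<in> edges B i"
      moreover from this have "edges B i \<subseteq> ?W \<times> ?W'"
        using closed unfolding closed_colored_graph_def by blast
      ultimately have "fst x \<in> ?W" "snd x \<in> ?W'" by auto
      then show "(case x of (v, w) \<Rightarrow> ?h v i = ?h w i) = (case x of (v, w) \<Rightarrow> n v i = m w i)"
        by (simp only: case_prod_unfold hW hW')
    qed
    have "(\<Prod>v\<in>?W. T (?h v)) = (\<Prod>v\<in>?W. T (n v))" "(\<Prod>w\<in>?W'. S (?h w)) = (\<Prod>w\<in>?W'. S (m w))"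
      by (intro prod.cong refl, simp only: hW hW')+
    then show "of_bool (?P (?j a) (?j a)) * ((\<Prod>v\<in>?W. T (?j a v)) * (\<Prod>w\<in>?W'. S (?j a w)))
      = (case a of (n, m) \<Rightarrow> of_bool (?P n m) * ((\<Prod>v\<in>?W. T (n v)) * (\<Prod>w\<in>?W'. S (m w))))"
      by (simp only: a prod.case P)
  next
    fix h assume h: "h \<in> ?V \<rightarrow>\<^sub>E ?I"
    show "?j (restrict h ?W, restrict h ?W') = h"
      using PiE_arb[OF h] by (auto simp: vertices_def fun_eq_iff)
    show "(restrict h ?W, restrict h ?W') \<in> (?W \<rightarrow>\<^sub>E ?I) \<times> (?W' \<rightarrow>\<^sub>E ?I)"
      using h by (auto simp: vertices_def)
  qed
  also have "\<dots> = (\<Sum>h\<in>labels N B. (\<Prod>v\<in>?W. T (h v)) * (\<Prod>w\<in>?W'. S (h w)))"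
    by (rule sum.mono_neutral_cong_right)
      (auto simp: labels_def no_zero_edges tensor_indices_def finite_vertices intro!: finite_PiE)
  finally show ?thesis .
qed

section \<open>Comparing labellings with covering graphs, and the limit\<close>

lemma labels_cover_subset: "G \<in> covering_graphs D B \<Longrightarrow> labels N G \<subseteq> labels N B"
  by (auto simp: covering_graphs_eq labels_cover)

text \<open>A union bound over the ordered pairs of distinct white vertices at which
  \<open>h\<close> may collide; there are at most \<open>(card (whites B))\<^sup>2\<close> of
  them.\<close>

lemma card_noninjective_labels:
  assumes G: "G \<in> covering_graphs D B" and D: "D \<ge> 1"
  shows "N * card {h \<in> labels N G. \<not> inj_on h (whites B)} \<le> (card (whites B))\<^sup>2 * N ^ max_faces"
proof -
  let ?P = "{(v, v') \<in> whites B \<times> whites B. v \<noteq> v'}"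
  let ?A = "\<lambda>(v, v'). {h \<in> labels N G. h v = h v'}"
  have finP: "finite ?P" by (rule finite_subset[of _ "whites B \<times> whites B"]) (auto simp: finite_whites)
  have fin: "finite (labels N G)" using finite_subset[OF labels_cover_subset[OF G] finite_labels] .
  have "{h \<in> labels N G. \<not> inj_on h (whites B)} \<subseteq> (\<Union>p\<in>?P. ?A p)"
    by (auto simp: inj_on_def)
  then have "card {h \<in> labels N G. \<not> inj_on h (whites B)} \<le> card (\<Union>p\<in>?P. ?A p)"
    by (intro card_mono) (use fin finP in auto)
  also have "\<dots> \<le> (\<Sum>p\<in>?P. card (?A p))" by (rule card_UN_le[OF finP])
  finally have "N * card {h \<in> labels N G. \<not> inj_on h (whites B)} \<le> (\<Sum>p\<in>?P. N * card (?A p))"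
    by (simp add: mult_le_mono2 flip: sum_distrib_left)
  also have "\<dots> \<le> (\<Sum>p\<in>?P. N ^ max_faces)"
    using G D card_labels_collision by (intro sum_mono) (auto simp: covering_graphs_eq)
  also have "\<dots> \<le> (card (whites B))\<^sup>2 * N ^ max_faces"
  proof -
    have "card ?P \<le> card (whites B \<times> whites B)"
      by (intro card_mono) (auto simp: finite_whites)
    then show ?thesis by (simp add: card_cartesian_product power2_eq_square mult_le_mono1)
  qed
  finally show ?thesis .
qed

text \<open>Double counting of the pairs of a labelling and a covering graph compatible with
  it.\<close>

lemma sum_card_covers:
  "(\<Sum>h\<in>labels N B. card {G \<in> covering_graphs D B. h \<in> labels N G \<and> P h})
   = (\<Sum>G\<in>covering_graphs D B. card {h \<in> labels N G. P h})"
proof -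
  have "(\<Sum>h\<in>labels N B. card {G \<in> covering_graphs D B. h \<in> labels N G \<and> P h})
     = (\<Sum>G\<in>covering_graphs D B. card {h \<in> labels N B. h \<in> labels N G \<and> P h})"
    by (rule sum_multicount_gen) (auto simp: finite_labels finite_covering_graphs)
  also have "\<dots> = (\<Sum>G\<in>covering_graphs D B. card {h \<in> labels N G. P h})"
    using labels_cover_subset by (intro sum.cong refl arg_cong[of _ _ card]) blast
  finally show ?thesis .
qed

text \<open>When the white labels are distinct, the label of a black vertex determines the white
  vertex matched to it.\<close>

lemma cover_unique:
  assumes t: "bij_betw t (whites B) (blacks B)" "\<forall>v\<in>whites B. h (t v) = h v"
    and t': "bij_betw t' (whites B) (blacks B)" "\<forall>v\<in>whites B. h (t' v) = h v"
    and inj: "inj_on h (whites B)"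
  shows "cover t = cover t'"
proof (rule cover_cong)
  fix v assume v: "v \<in> whites B"
  have "t' v \<in> t ` whites B"
    using bij_betw_apply[OF t'(1) v] bij_betw_imp_surj_on[OF t(1)] by simp
  then obtain u where u: "t' v = t u" "u \<in> whites B" by (rule imageE)
  then have "h u = h v" using bspec[OF t(2) u(2)] bspec[OF t'(2) v] u(1) by simp
  from inj_onD[OF inj this u(2) v] show "t v = t' v" using u(1) by simp
qed

text \<open>Here probability is abstracted away: \<open>\<phi> h\<close> stands for the expected
  contribution of \<open>h\<close>, and \<open>s\<close> for its value on compatible injective
  labellings. It differs from \<open>s\<close> times the number of covering graphs compatible with
  \<open>h\<close> only at non-injective \<open>h\<close>, and these are rarer by a factor
  \<open>N\<close>.\<close>

lemma sum_labels_bound: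
  fixes \<phi> :: "('v \<Rightarrow> nat \<Rightarrow> nat) \<Rightarrow> complex"
  assumes D: "D \<ge> 1" and K: "K \<ge> 0"
    and bound: "\<And>h. h \<in> labels N B \<Longrightarrow> norm (\<phi> h) \<le> K"
    and supp: "\<And>h. h \<in> labels N B \<Longrightarrow> \<phi> h \<noteq> 0 \<Longrightarrow>
      \<exists>t. bij_betw t (whites B) (blacks B) \<and> (\<forall>v\<in>whites B. h (t v) = h v)"
    and inj: "\<And>h t. h \<in> labels N B \<Longrightarrow> bij_betw t (whites B) (blacks B) \<Longrightarrow>
      \<forall>v\<in>whites B. h (t v) = h v \<Longrightarrow> inj_on h (whites B) \<Longrightarrow> \<phi> h = s"
  shows "N * norm ((\<Sum>h\<in>labels N B. \<phi> h) - s * (\<Sum>G\<in>covering_graphs D B. of_nat N ^ zero_faces D G))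
    \<le> (K + norm s) * (card (covering_graphs D B) * (card (whites B))\<^sup>2) * N ^ max_faces"
proof -
  let ?C = "covering_graphs D B" and ?W = "whites B"
  let ?c = "\<lambda>h. card {G \<in> ?C. h \<in> labels N G}"
  let ?c' = "\<lambda>h. card {G \<in> ?C. h \<in> labels N G \<and> \<not> inj_on h ?W}"
  have mem: "h \<in> labels N (cover t) \<longleftrightarrow> (\<forall>v\<in>?W. h (t v) = h v)"
    if "h \<in> labels N B" "bij_betw t ?W (blacks B)" for h t
    using labels_cover[OF that(2), of N] that(1) by auto
  \<comment> \<open>Without a compatible covering graph both terms vanish; for injective
    \<open>h\<close> there is exactly one and the terms cancel; otherwise
    \<open>?c' h = ?c h \<ge> 1\<close> and the triangle inequality suffices.\<close>
  have c: "norm (\<phi> h - s * ?c h) \<le> (K + norm s) * ?c' h" if h: "h \<in> labels N B" for h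
  proof (cases "?c h = 0")
    case True
    then have none: "{G \<in> ?C. h \<in> labels N G} = {}" using finite_covering_graphs by simp
    have "\<phi> h = 0"
    proof (rule ccontr)
      assume "\<phi> h \<noteq> 0"
      then obtain t where "bij_betw t ?W (blacks B)" "\<forall>v\<in>?W. h (t v) = h v" using supp[OF h] by blast
      then show False using none mem[OF h] by (auto simp: covering_graphs_eq)
    qed
    then show ?thesis using True K by simp
  next
    case False
    then have "{G \<in> ?C. h \<in> labels N G} \<noteq> {}" by (metis card.empty)
    then obtain G where "G \<in> ?C" and hG: "h \<in> labels N G" by blast
    then obtain t where t1: "bij_betw t ?W (blacks B)" and Gt: "G = cover t"
      by (auto simp: covering_graphs_eq)
    then have t: "bij_betw t ?W (blacks B)" "\<forall>v\<in>?W. h (t v) = h v" using mem[OF h t1] hG by simp_all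
    show ?thesis
    proof (cases "inj_on h ?W")
      case True
      have "{G \<in> ?C. h \<in> labels N G} = {cover t}"
      proof (intro set_eqI iffI)
        fix H assume H: "H \<in> {G \<in> ?C. h \<in> labels N G}"
        then obtain t' where t': "bij_betw t' ?W (blacks B)" and "H = cover t'"
          by (auto simp: covering_graphs_eq)
        moreover have "\<forall>v\<in>?W. h (t' v) = h v" using H mem[OF h t'] \<open>H = cover t'\<close> by simp
        ultimately show "H \<in> {cover t}" using cover_unique[OF t' _ t True] by simp
      next
        fix H assume "H \<in> {cover t}"
        then show "H \<in> {G \<in> ?C. h \<in> labels N G}"
          using hG Gt \<open>G \<in> ?C\<close> by simp
      qed
      then have "\<phi> h - s * ?c h = 0" using inj[OF h t True] by simp
      then show ?thesis using K by simp
    next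
      case ni: False
      have "norm (\<phi> h - s * ?c h) \<le> norm (\<phi> h) + norm s * ?c h"
        using norm_triangle_ineq4[of "\<phi> h" "s * ?c h"] by (simp only: norm_mult norm_of_nat)
      also have "\<dots> \<le> K * ?c h + norm s * ?c h"
      proof (intro add_right_mono)
        have "norm (\<phi> h) \<le> K * 1" using bound[OF h] by simp
        also have "\<dots> \<le> K * ?c h" using K False by (intro mult_left_mono) auto
        finally show "norm (\<phi> h) \<le> K * ?c h" .
      qed
      finally show ?thesis using ni by (simp add: distrib_right)
    qed
  qed
  \<comment> \<open>Counting graph by graph replaces the multiplicities \<open>?c h\<close> by
    powers of \<open>N\<close>.\<close>
  have "(\<Sum>h\<in>labels N B. of_nat (?c h)) = (\<Sum>G\<in>?C. of_nat N ^ zero_faces D G :: complex)"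
  proof -
    have "(\<Sum>h\<in>labels N B. ?c h) = (\<Sum>G\<in>?C. card (labels N G))"
      using sum_card_covers[of N "\<lambda>_. True"] by simp
    also have "\<dots> = (\<Sum>G\<in>?C. N ^ zero_faces D G)"
      by (intro sum.cong refl) (auto simp: covering_graphs_eq card_labels_cover)
    finally have "of_nat (\<Sum>h\<in>labels N B. ?c h) = (of_nat (\<Sum>G\<in>?C. N ^ zero_faces D G) :: complex)"
      by (rule arg_cong)
    then show ?thesis by simp
  qed
  then have "(\<Sum>h\<in>labels N B. \<phi> h) - s * (\<Sum>G\<in>?C. of_nat N ^ zero_faces D G)
      = (\<Sum>h\<in>labels N B. \<phi> h - s * ?c h)"
    by (simp add: sum_subtractf sum_distrib_left flip: sum_distrib_left)
  then have "norm ((\<Sum>h\<in>labels N B. \<phi> h) - s * (\<Sum>G\<in>?C. of_nat N ^ zero_faces D G))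
      \<le> (\<Sum>h\<in>labels N B. (K + norm s) * ?c' h)"
    using c by (simp add: sum_norm_le)
  also have "\<dots> = (K + norm s) * real (\<Sum>G\<in>?C. card {h \<in> labels N G. \<not> inj_on h ?W})"
    unfolding sum_card_covers[symmetric] by (simp add: sum_distrib_left)
  finally have "N * norm ((\<Sum>h\<in>labels N B. \<phi> h) - s * (\<Sum>G\<in>?C. of_nat N ^ zero_faces D G))
      \<le> N * ((K + norm s) * real (\<Sum>G\<in>?C. card {h \<in> labels N G. \<not> inj_on h ?W}))"
    by (rule mult_left_mono) simp
  also have "\<dots> = (K + norm s) * real (\<Sum>G\<in>?C. N * card {h \<in> labels N G. \<not> inj_on h ?W})"
    by (simp add: mult.left_commute flip: sum_distrib_left)
  also have "\<dots> \<le> (K + norm s) * real (\<Sum>G\<in>?C. (card ?W)\<^sup>2 * N ^ max_faces)"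
    using K card_noninjective_labels[OF _ D] by (intro mult_left_mono of_nat_mono sum_mono) auto
  also have "\<dots> = (K + norm s) * (card ?C * (card ?W)\<^sup>2) * real N ^ max_faces" by simp
  finally show ?thesis .
qed

text \<open>After division by \<open>N ^ max_faces\<close> the error is of order
  \<open>1 / N\<close>. A covering graph with the maximal number of faces contributes
  \<open>s\<close>, and any other loses at least one power of \<open>N\<close> and tends to
  0.\<close>

lemma sum_labels_limit:
  fixes \<phi> :: "nat \<Rightarrow> ('v \<Rightarrow> nat \<Rightarrow> nat) \<Rightarrow> complex"
  assumes D: "D \<ge> 1" and K: "K \<ge> 0"
    and bound: "\<And>N h. N \<ge> 1 \<Longrightarrow> h \<in> labels N B \<Longrightarrow> norm (\<phi> N h) \<le> K"
    and supp: "\<And>N h. N \<ge> 1 \<Longrightarrow> h \<in> labels N B \<Longrightarrow> \<phi> N h \<noteq> 0 \<Longrightarrow>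
      \<exists>t. bij_betw t (whites B) (blacks B) \<and> (\<forall>v\<in>whites B. h (t v) = h v)"
    and inj: "\<And>N h t. N \<ge> 1 \<Longrightarrow> h \<in> labels N B \<Longrightarrow> bij_betw t (whites B) (blacks B) \<Longrightarrow>
      \<forall>v\<in>whites B. h (t v) = h v \<Longrightarrow> inj_on h (whites B) \<Longrightarrow> \<phi> N h = s"
  shows "(\<lambda>N. (\<Sum>h\<in>labels N B. \<phi> N h) / of_nat N ^ max_faces)
    \<longlonglongrightarrow> s * of_nat (num_minimal_coverings D B)"
proof -
  let ?C = "covering_graphs D B" and ?M = max_faces
  let ?E = "\<lambda>N. ((\<Sum>h\<in>labels N B. \<phi> N h) - s * (\<Sum>G\<in>?C. of_nat N ^ zero_faces D G)) / of_nat N ^ ?M"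
  let ?L = "\<lambda>N. \<Sum>G\<in>?C. of_nat N ^ zero_faces D G / of_nat N ^ ?M :: complex"
  define A where "A = (K + norm s) * (card ?C * (card (whites B))\<^sup>2)"
  have "norm (?E N) \<le> A / real N" if "N \<ge> 1" for N
  proof -
    have "N * norm ((\<Sum>h\<in>labels N B. \<phi> N h) - s * (\<Sum>G\<in>?C. of_nat N ^ zero_faces D G)) \<le> A * real N ^ ?M"
      unfolding A_def by (rule sum_labels_bound[OF D K bound[OF that] supp[OF that] inj[OF that]])
    then show ?thesis using that by (simp add: norm_divide norm_power field_simps)
  qed
  then have "eventually (\<lambda>N. norm (?E N) \<le> A / real N) sequentially"
    by (rule eventually_sequentiallyI[of 1])
  moreover have "(\<lambda>N. A / real N) \<longlonglongrightarrow> 0" by (rule lim_const_over_n)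
  ultimately have E: "?E \<longlonglongrightarrow> 0" by (rule Lim_null_comparison)
  have "(\<lambda>N. of_nat N ^ zero_faces D G / of_nat N ^ ?M :: complex) \<longlonglongrightarrow> of_bool (zero_faces D G = ?M)"
    if G: "G \<in> ?C" for G
  proof (cases "zero_faces D G = ?M")
    case True
    have "eventually (\<lambda>N. of_nat N ^ zero_faces D G / of_nat N ^ ?M = (1::complex)) sequentially"
      by (rule eventually_sequentiallyI[of 1]) (simp add: True)
    then show ?thesis using True by (simp add: tendsto_eventually)
  next
    case False
    then obtain j where j: "?M = zero_faces D G + Suc j"
      using zero_faces_le[OF G] by (metis add_Suc_right le_neq_implies_less less_imp_Suc_add)
    have "(\<lambda>N. (inverse (of_nat N)) ^ Suc j :: complex) \<longlonglongrightarrow> 0 ^ Suc j"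
      by (intro tendsto_power lim_inverse_n)
    moreover have "eventually (\<lambda>N. (inverse (of_nat N)) ^ Suc j
        = (of_nat N ^ zero_faces D G / of_nat N ^ ?M :: complex)) sequentially"
      by (rule eventually_sequentiallyI[of 1]) (simp add: j power_add divide_simps)
    ultimately have "(\<lambda>N. of_nat N ^ zero_faces D G / of_nat N ^ ?M :: complex) \<longlonglongrightarrow> 0"
      using Lim_transform_eventually by fastforce
    then show ?thesis using False by simp
  qed
  then have "?L \<longlonglongrightarrow> (\<Sum>G\<in>?C. of_bool (zero_faces D G = ?M))" by (rule tendsto_sum)
  also have "(\<Sum>G\<in>?C. of_bool (zero_faces D G = ?M)) = (of_nat (num_minimal_coverings D B) :: complex)"
    using finite_covering_graphs
    by (simp add: num_minimal_coverings_def minimal_covering_graphs_eq sum.If_cases of_bool_def Int_def)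
  finally have "(\<lambda>N. ?E N + s * ?L N) \<longlonglongrightarrow> 0 + s * of_nat (num_minimal_coverings D B)"
    by (intro tendsto_add E tendsto_mult tendsto_const)
  moreover have "?E N + s * ?L N = (\<Sum>h\<in>labels N B. \<phi> N h) / of_nat N ^ ?M" for N
    by (simp add: diff_divide_distrib flip: sum_divide_distrib)
  ultimately show ?thesis by simp
qed

end

section \<open>Expectations of trace invariants\<close>

text \<open>Vertices with the same index are collected first, so that the product runs over
  distinct, hence independent, variables. Each factor is integrable because its modulus is a power
  of \<open>cmod (T x \<omega>)\<close>.\<close>

lemma (in prob_space) mixed_moment_indep:
  fixes T :: "'i \<Rightarrow> 'a \<Rightarrow> complex" and h :: "'v \<Rightarrow> 'i"
  assumes indep: "indep_vars (\<lambda>_. borel) T I"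
    and mom: "\<And>x p. x \<in> I \<Longrightarrow> integrable M (\<lambda>\<omega>. cmod (T x \<omega>) ^ p)"
    and fin: "finite W" "finite W'" and h: "h ` (W \<union> W') \<subseteq> I"
  shows "integrable M (\<lambda>\<omega>. (\<Prod>v\<in>W. T (h v) \<omega>) * (\<Prod>w\<in>W'. cnj (T (h w) \<omega>)))"
    and "expectation (\<lambda>\<omega>. (\<Prod>v\<in>W. T (h v) \<omega>) * (\<Prod>w\<in>W'. cnj (T (h w) \<omega>)))
      = (\<Prod>x\<in>h ` (W \<union> W'). expectation (\<lambda>\<omega>.
          T x \<omega> ^ card {v \<in> W. h v = x} * cnj (T x \<omega>) ^ card {w \<in> W'. h w = x}))"
proof -
  let ?S = "h ` (W \<union> W')"
  let ?a = "\<lambda>x. card {v \<in> W. h v = x}" and ?b = "\<lambda>x. card {w \<in> W'. h w = x}"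
  let ?X = "\<lambda>x \<omega>. T x \<omega> ^ ?a x * cnj (T x \<omega>) ^ ?b x"
  have eq: "(\<Prod>v\<in>W. T (h v) \<omega>) * (\<Prod>w\<in>W'. cnj (T (h w) \<omega>)) = (\<Prod>x\<in>?S. ?X x \<omega>)" for \<omega>
    using fin prod_fibres[of W ?S h "\<lambda>x. T x \<omega>"] prod_fibres[of W' ?S h "\<lambda>x. cnj (T x \<omega>)"]
    by (simp add: prod.distrib image_mono)
  have finS: "finite ?S" using fin by simp
  have [measurable]: "cnj \<in> borel_measurable borel"
    by (intro borel_measurable_continuous_onI continuous_intros)
  have ind: "indep_vars (\<lambda>_. borel) ?X ?S"
    by (rule indep_vars_compose2[OF indep_vars_subset[OF indep h]]) measurable
  have T: "T x \<in> borel_measurable M" if "x \<in> I" for x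
    using indep that by (auto simp: indep_vars_def)
  have int: "integrable M (?X x)" if "x \<in> ?S" for x
  proof (rule Bochner_Integration.integrable_bound[OF mom[of x "?a x + ?b x"]])
    show "x \<in> I" using that h by blast
    then show "?X x \<in> borel_measurable M" using T by measurable
    show "AE \<omega> in M. norm (?X x \<omega>) \<le> norm (cmod (T x \<omega>) ^ (?a x + ?b x))"
      by (simp add: norm_mult norm_power power_add)
  qed
  show "integrable M (\<lambda>\<omega>. (\<Prod>v\<in>W. T (h v) \<omega>) * (\<Prod>w\<in>W'. cnj (T (h w) \<omega>)))"
    unfolding eq by (rule indep_vars_integrable[OF finS ind int])
  show "expectation (\<lambda>\<omega>. (\<Prod>v\<in>W. T (h v) \<omega>) * (\<Prod>w\<in>W'. cnj (T (h w) \<omega>)))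
      = (\<Prod>x\<in>?S. expectation (?X x))"
    unfolding eq by (rule indep_vars_lebesgue_integral[OF finS ind int])
qed

theorem theorem1:
  fixes D :: nat
    and M :: "nat \<Rightarrow> 'w measure"
    and T :: "nat \<Rightarrow> (nat \<Rightarrow> nat) \<Rightarrow> 'w \<Rightarrow> complex"
    and \<mu> :: "complex measure"
    and \<sigma> :: real
    and B :: "'v colored_graph"
  assumes "D \<ge> 3"
    and "\<And>N. N \<ge> 1 \<Longrightarrow> prob_space (M N)"
    and "\<And>N. N \<ge> 1 \<Longrightarrow>
           prob_space.indep_vars (M N) (\<lambda>_. borel) (T N) (tensor_indices D N)"
    and "\<And>N n. N \<ge> 1 \<Longrightarrow> n \<in> tensor_indices D N \<Longrightarrow> distr (M N) borel (T N n) = \<mu>"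
    and "\<And>N n p. N \<ge> 1 \<Longrightarrow> n \<in> tensor_indices D N \<Longrightarrow>
           integrable (M N) (\<lambda>\<omega>. cmod (T N n \<omega>) ^ (p :: nat))"
    and "\<And>N n a b. N \<ge> 1 \<Longrightarrow> n \<in> tensor_indices D N \<Longrightarrow> a \<noteq> (b :: nat) \<Longrightarrow>
           prob_space.expectation (M N) (\<lambda>\<omega>. T N n \<omega> ^ a * cnj (T N n \<omega>) ^ b) = 0"
    and "\<And>N n. N \<ge> 1 \<Longrightarrow> n \<in> tensor_indices D N \<Longrightarrow>
           prob_space.expectation (M N) (\<lambda>\<omega>. T N n \<omega> * cnj (T N n \<omega>)) = complex_of_real (\<sigma>\<^sup>2)"
    and "closed_colored_graph {1..D} B"
    and "connected_colored_graph {1..D} B"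
  shows "(\<lambda>N. complex_of_real (real N powi (- 1 + Omega D B)) *
            prob_space.expectation (M N) (\<lambda>\<omega>.
              trace_invariant D N B
                (rescaled_tensor D N (\<lambda>n. T N n \<omega>))
                (\<lambda>n. cnj (rescaled_tensor D N (\<lambda>n'. T N n' \<omega>) n))))
         \<longlonglongrightarrow> complex_of_real (\<sigma> ^ (2 * half_order B) * real (num_minimal_coverings D B))"
proof -
  interpret base_graph D B by unfold_locales (rule assms(8))
  let ?W = "whites B" and ?W' = "blacks B" and ?k = "card (whites B)"
  let ?a = "\<lambda>h x. card {v \<in> ?W. h v = x}" and ?b = "\<lambda>h x. card {w \<in> ?W'. h w = x}"
  define X where "X N h \<omega> = (\<Prod>v\<in>?W. T N (h v) \<omega>) * (\<Prod>w\<in>?W'. cnj (T N (h w) \<omega>))" for N h \<omega>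
  define \<phi> where "\<phi> N h = prob_space.expectation (M N) (X N h)" for N h
  \<comment> \<open>Absolute moments are taken under the common law \<open>\<mu>\<close>, so that
    bounds built from them do not depend on \<open>N\<close>.\<close>
  define m where "m p = (\<integral>z. cmod z ^ p \<partial>\<mu>)" for p :: nat
  \<comment> \<open>The sum dominates every absolute moment of order at most \<open>2k\<close>, the
    largest possible multiplicity of an index; the summand 1 ensures \<open>c \<ge> 1\<close>, so
    that powers of \<open>c\<close> increase with the exponent.\<close>
  define c where "c = 1 + (\<Sum>p\<le>?k + ?k. m p)"
  have m: "(\<integral>\<omega>. cmod (T N n \<omega>) ^ p \<partial>M N) = m p" if "N \<ge> 1" "n \<in> tensor_indices D N" for N n p
  proof -
    have "T N n \<in> borel_measurable (M N)"
      using assms(3)[OF that(1)] that(2) by (auto simp: prob_space.indep_vars_def[OF assms(2)[OF that(1)]])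
    then show ?thesis
      unfolding m_def assms(4)[OF that, symmetric] by (intro integral_distr[symmetric]) simp_all
  qed
  have m_nonneg: "m p \<ge> 0" for p by (simp add: m_def)
  then have c1: "c \<ge> 1" by (simp add: c_def sum_nonneg)
  have range: "h ` (?W \<union> ?W') \<subseteq> tensor_indices D N" if "h \<in> labels N B" for N h
    using that by (auto simp: labels_def vertices_def)
  note mixed = prob_space.mixed_moment_indep[OF assms(2) assms(3) assms(5) finite_whites finite_blacks range]
  have int: "integrable (M N) (X N h)" if "N \<ge> 1" "h \<in> labels N B" for N h
    unfolding X_def by (rule mixed(1)) (use that in auto)
  have \<phi>: "\<phi> N h = (\<Prod>x\<in>h ` (?W \<union> ?W'). prob_space.expectation (M N)
      (\<lambda>\<omega>. T N x \<omega> ^ ?a h x * cnj (T N x \<omega>) ^ ?b h x))" if "N \<ge> 1" "h \<in> labels N B" for N h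
    unfolding \<phi>_def X_def by (rule mixed(2)) (use that in auto)
  have lim: "(\<lambda>N. (\<Sum>h\<in>labels N B. \<phi> N h) / of_nat N ^ max_faces)
      \<longlonglongrightarrow> complex_of_real (\<sigma>\<^sup>2) ^ ?k * of_nat (num_minimal_coverings D B)"
  proof (rule sum_labels_limit[where K = "c ^ (?k + ?k)"])
    show "D \<ge> 1" "0 \<le> c ^ (?k + ?k)" using assms(1) c1 by auto
  next
    \<comment> \<open>At most \<open>2k\<close> distinct indices occur, and each contributes a
      factor of norm at most \<open>c\<close>; this bound is uniform in \<open>N\<close> and
      \<open>h\<close>.\<close>
    fix N h assume N: "(N::nat) \<ge> 1" and h: "h \<in> labels N B"
    have fac: "norm (prob_space.expectation (M N) (\<lambda>\<omega>. T N x \<omega> ^ ?a h x * cnj (T N x \<omega>) ^ ?b h x)) \<le> c"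
      if "x \<in> h ` (?W \<union> ?W')" for x
    proof -
      have x: "x \<in> tensor_indices D N" using that range[OF h] by blast
      have "norm (prob_space.expectation (M N) (\<lambda>\<omega>. T N x \<omega> ^ ?a h x * cnj (T N x \<omega>) ^ ?b h x))
          \<le> (\<integral>\<omega>. norm (T N x \<omega> ^ ?a h x * cnj (T N x \<omega>) ^ ?b h x) \<partial>M N)"
        by (rule integral_norm_bound)
      also have "\<dots> = m (?a h x + ?b h x)"
        by (simp add: norm_mult norm_power m[OF N x] flip: power_add)
      also have "\<dots> \<le> (\<Sum>p\<le>?k + ?k. m p)"
      proof (rule member_le_sum)
        have "?a h x \<le> ?k" "?b h x \<le> card ?W'"
          by (intro card_mono finite_whites finite_blacks; auto)+
        then show "?a h x + ?b h x \<in> {..?k + ?k}" using card_eq by simp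
      qed (use m_nonneg in auto)
      finally show ?thesis by (simp add: c_def)
    qed
    have "norm (\<phi> N h) \<le> (\<Prod>x\<in>h ` (?W \<union> ?W'). c)"
      unfolding \<phi>[OF N h] prod_norm[symmetric] by (intro prod_mono conjI norm_ge_zero fac)
    also have "\<dots> = c ^ card (h ` (?W \<union> ?W'))" by simp
    also have "\<dots> \<le> c ^ (?k + ?k)"
    proof (rule power_increasing[OF _ c1])
      have "card (h ` (?W \<union> ?W')) \<le> card (?W \<union> ?W')"
        by (intro card_image_le) (simp add: finite_whites finite_blacks)
      also have "\<dots> \<le> ?k + ?k" using card_Un_le[of ?W ?W'] card_eq by simp
      finally show "card (h ` (?W \<union> ?W')) \<le> ?k + ?k" .
    qed
    finally show "norm (\<phi> N h) \<le> c ^ (?k + ?k)" .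
  next
    fix N h assume N: "(N::nat) \<ge> 1" and h: "h \<in> labels N B" and nz: "\<phi> N h \<noteq> 0"
    \<comment> \<open>By evenness, an index with different multiplicities on white and black
      vertices makes its factor, and hence \<open>\<phi> N h\<close>, vanish; an index that does not
      occur has multiplicity 0 on both sides.\<close>
    have "?a h x = ?b h x" for x
    proof (cases "x \<in> h ` (?W \<union> ?W')")
      case True
      then have x: "x \<in> tensor_indices D N" using range[OF h] by blast
      have "prob_space.expectation (M N) (\<lambda>\<omega>. T N x \<omega> ^ ?a h x * cnj (T N x \<omega>) ^ ?b h x) \<noteq> 0"
        using nz True unfolding \<phi>[OF N h] by (auto simp: finite_whites finite_blacks)
      then show ?thesis using assms(6)[OF N x] by blast
    next
      case False
      then have "{v \<in> ?W. h v = x} = {}" "{w \<in> ?W'. h w = x} = {}" by auto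
      then show ?thesis by (simp only:)
    qed
    then show "\<exists>t. bij_betw t ?W ?W' \<and> (\<forall>v\<in>?W. h (t v) = h v)"
      by (rule exists_bij_betw_fibres[OF finite_whites finite_blacks])
  next
    fix N h t assume N: "(N::nat) \<ge> 1" and h: "h \<in> labels N B" and t: "bij_betw t ?W ?W'"
      and ht: "\<forall>v\<in>?W. h (t v) = h v" and inj: "inj_on h ?W"
    have im: "h ` (?W \<union> ?W') = h ` ?W"
    proof -
      have "h ` ?W' = h ` t ` ?W" using bij_betw_imp_surj_on[OF t] by simp
      also have "\<dots> = h ` ?W" unfolding image_image using ht by (intro image_cong refl) simp
      finally show ?thesis by (simp add: image_Un)
    qed
    \<comment> \<open>With injective white labels each index occurs at exactly one white vertex
      \<open>v\<close> and one black vertex \<open>t v\<close>, so each factor is the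
      covariance.\<close>
    have "\<phi> N h = (\<Prod>x\<in>h ` ?W. complex_of_real (\<sigma>\<^sup>2))"
      unfolding \<phi>[OF N h] im
    proof (rule prod.cong[OF refl])
      fix x assume "x \<in> h ` ?W"
      then obtain v where v: "v \<in> ?W" "x = h v" by blast
      have x: "x \<in> tensor_indices D N" using range[OF h] v by blast
      have uniq: "u = v" if "u \<in> ?W" "h u = x" for u using inj_onD[OF inj _ that(1) v(1)] that v by simp
      have "{u \<in> ?W. h u = x} = {v}" using v uniq by auto
      moreover have "{w \<in> ?W'. h w = x} = {t v}"
      proof (intro set_eqI iffI)
        fix w assume w: "w \<in> {w \<in> ?W'. h w = x}"
        then have "w \<in> t ` ?W" using bij_betw_imp_surj_on[OF t] by simp
        then obtain u where u: "w = t u" "u \<in> ?W" by (rule imageE)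
        then have "h u = x" using bspec[OF ht u(2)] w by simp
        then show "w \<in> {t v}" using uniq[OF u(2)] u(1) by simp
      next
        fix w assume "w \<in> {t v}"
        then show "w \<in> {w \<in> ?W'. h w = x}" using bij_betw_apply[OF t v(1)] bspec[OF ht v(1)] v(2) by simp
      qed
      ultimately show "prob_space.expectation (M N) (\<lambda>\<omega>. T N x \<omega> ^ ?a h x * cnj (T N x \<omega>) ^ ?b h x)
          = complex_of_real (\<sigma>\<^sup>2)"
        using assms(7)[OF N x] by simp
    qed
    also have "\<dots> = complex_of_real (\<sigma>\<^sup>2) ^ ?k" by (simp add: card_image[OF inj])
    finally show "\<phi> N h = complex_of_real (\<sigma>\<^sup>2) ^ ?k" .
  qed
  have eq: "complex_of_real (real N powi (- 1 + Omega D B)) * prob_space.expectation (M N) (\<lambda>\<omega>.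
      trace_invariant D N B (rescaled_tensor D N (\<lambda>n. T N n \<omega>))
        (\<lambda>n. cnj (rescaled_tensor D N (\<lambda>n'. T N n' \<omega>) n)))
    = (\<Sum>h\<in>labels N B. \<phi> N h) / of_nat N ^ max_faces" if N: "N \<ge> 1" for N
  proof -
    \<comment> \<open>Each of the \<open>2k\<close> tensors carries a factor \<open>r\<close>, in
      total \<open>N\<close> to the power \<open>-(D - 1) k\<close>. This cancels the corresponding
      part of \<open>Omega\<close> and leaves \<open>1 / N ^ max_faces\<close>.\<close>
    define r where "r = real N powr (- (real D - 1) / 2)"
    have "r\<^sup>2 = real N powr (- real (D - 1))"
      using assms(1) N by (simp add: r_def power2_eq_square of_nat_diff flip: powr_add)
    also have "\<dots> = inverse (real N ^ (D - 1))"
      unfolding powr_minus using N by (subst powr_realpow) simp_all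
    finally have r2: "r\<^sup>2 = inverse (real N ^ (D - 1))" .
    have "r ^ ?k * r ^ ?k = (r\<^sup>2) ^ ?k" by (simp add: power2_eq_square power_mult_distrib)
    also have "\<dots> = inverse (real N ^ ((D - 1) * ?k))" by (simp add: r2 power_mult power_inverse)
    finally have rr: "r ^ ?k * r ^ ?k = inverse (real N ^ ((D - 1) * ?k))" .
    have "- 1 + Omega D B = int ((D - 1) * ?k) - int max_faces"
      using assms(1) by (simp add: Omega_def max_faces_def half_order_eq of_nat_diff)
    then have "real N powi (- 1 + Omega D B) = real N ^ ((D - 1) * ?k) / real N ^ max_faces"
      using N by (simp add: power_int_diff del: of_nat_mult)
    then have scale: "real N powi (- 1 + Omega D B) * (r ^ ?k * r ^ ?k) = 1 / real N ^ max_faces"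
      unfolding rr using N by simp
    have "trace_invariant D N B (rescaled_tensor D N (\<lambda>n. T N n \<omega>))
        (\<lambda>n. cnj (rescaled_tensor D N (\<lambda>n'. T N n' \<omega>) n))
      = complex_of_real (r ^ ?k * r ^ ?k) * (\<Sum>h\<in>labels N B. X N h \<omega>)" for \<omega>
      unfolding trace_invariant_labels rescaled_tensor_def r_def[symmetric] X_def sum_distrib_left
      by (intro sum.cong refl) (simp add: prod.distrib flip: card_eq)
    then have "prob_space.expectation (M N) (\<lambda>\<omega>.
      trace_invariant D N B (rescaled_tensor D N (\<lambda>n. T N n \<omega>))
        (\<lambda>n. cnj (rescaled_tensor D N (\<lambda>n'. T N n' \<omega>) n)))
      = complex_of_real (r ^ ?k * r ^ ?k) * (\<Sum>h\<in>labels N B. \<phi> N h)"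
      using int[OF N] by (simp add: \<phi>_def Bochner_Integration.integral_sum)
    then have "complex_of_real (real N powi (- 1 + Omega D B)) * prob_space.expectation (M N) (\<lambda>\<omega>.
      trace_invariant D N B (rescaled_tensor D N (\<lambda>n. T N n \<omega>))
        (\<lambda>n. cnj (rescaled_tensor D N (\<lambda>n'. T N n' \<omega>) n)))
      = complex_of_real (real N powi (- 1 + Omega D B) * (r ^ ?k * r ^ ?k)) * (\<Sum>h\<in>labels N B. \<phi> N h)"
      by (simp only: of_real_mult mult.assoc)
    also have "\<dots> = (\<Sum>h\<in>labels N B. \<phi> N h) / of_nat N ^ max_faces"
      unfolding scale by simp
    finally show ?thesis .
  qed
  have "\<forall>\<^sub>F N in sequentially. (\<Sum>h\<in>labels N B. \<phi> N h) / of_nat N ^ max_faces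
    = complex_of_real (real N powi (- 1 + Omega D B)) * prob_space.expectation (M N) (\<lambda>\<omega>.
      trace_invariant D N B (rescaled_tensor D N (\<lambda>n. T N n \<omega>))
        (\<lambda>n. cnj (rescaled_tensor D N (\<lambda>n'. T N n' \<omega>) n)))"
    by (rule eventually_sequentiallyI[of 1]) (rule eq[symmetric])
  from Lim_transform_eventually[OF lim this] show ?thesis
    by (simp add: half_order_eq power_mult)
qed

end
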